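(* Let $b$ be a graph over the discrete measure space $(X,m)$, let $d$ be an intrinsic metric for $b$ on $(X,m)$, let $L$ be the associated graph Laplacian on $\ell^2(X,m)$, and let $\alpha=\alpha_{d,m}(X)$ be the associated isoperimetric constant. Let $n(x)=\sum_{y\in X}b(x,y)$. Suppose that $m(x)\ge n(x)$ for all $x\in X$, and that either $d(x,y)\ge1$ for all $x\sim y$, or $d(x,y)\le1$ for all $x\sim y$. Then $$\lambda_0(L)\ \ge\ 1-\sqrt{1-\alpha^{2}}.$$
   Context: Measure space: $X$ is a countably infinite set with the discrete topology, $m:X\to(0,\infty)$, and $m(A)=\sum_{x\in A}m(x)$ for $A\subseteq X$. Graph: a graph over $(X,m)$ is a symmetric function $b:X\times X\to[0,\infty)$ with $b(x,x)=0$ for all $x$ and $\sum_{y\in X}b(x,y)<\infty$ for all $x\in X$. Write $x\sim y$ (neighbors) if $b(x,y)>0$. It is assumed that every vertex has at least one neighbor. Intrinsic metric: a pseudo metric $d$ on $X$ is called an intrinsic metric for $b$ on $(X,m)$ if $\sum_{y\in X}b(x,y)d(x,y)^2\le m(x)$ for all $x\in X$. Isoperimetric constant: for $W\subseteq X$ let $\partial W=\{(x,y)\in W\times (X\setminus W): b(x,y)>0\}$ and $|\partial W|=\sum_{(x,y)\in\partial W}b(x,y)d(x,y)$. For $U\subseteq X$ set $\alpha(U)=\alpha_{d,m}(U)=\inf\{|\partial W|/m(W): W\subseteq U \text{ finite, nonempty}\}$, and $\alpha=\alpha(X)$. Laplacian: $\ell^2(X,m)$ is the real Hilbert space of functions $u:X\to\mathbb{R}$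 with $\sum_x u(x)^2m(x)<\infty$, with inner product $\langle u,v\rangle=\sum_x u(x)v(x)m(x)$ and norm $\|\cdot\|$. $C_c(X)$ is the space of finitely supported real functions on $X$. The form $Q$ is $Q(u)=\frac12\sum_{x,y\in X}b(x,y)(u(x)-u(y))^2$ with domain $D=\overline{C_c(X)}^{\|\cdot\|_Q}$, where $\|u\|_Q=(Q(u)+\|u\|^2)^{1/2}$ (closure taken within $\{u\in\ell^2(X,m):Q(u)<\infty\}$). It is a closed form (a regular Dirichlet form), and $L$ denotes the corresponding positive selfadjoint operator on $\ell^2(X,m)$. $\lambda_0(L)=\inf\sigma(L)$ is the bottom of the spectrum of $L$. *)

theory Defs
  imports "HOL-Analysis.Analysis"
begin

text \<open>
  The vertex set \<open>X\<close> is the universe of the type \<open>'a\<close>. Since \<open>infsum\<close> is \<open>0\<close> for sums that do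
  not converge, finiteness of a sum is always demanded explicitly by \<open>summable_on\<close>.
\<close>

definition discrete_measure_space :: "('a \<Rightarrow> real) \<Rightarrow> bool" where
  "discrete_measure_space m \<longleftrightarrow>
     countable (UNIV :: 'a set) \<and> infinite (UNIV :: 'a set) \<and> (\<forall>x. m x > 0)"

definition graph :: "('a \<Rightarrow> 'a \<Rightarrow> real) \<Rightarrow> bool" where
  "graph b \<longleftrightarrow>
     (\<forall>x y. b x y \<ge> 0) \<and> (\<forall>x y. b x y = b y x) \<and> (\<forall>x. b x x = 0) \<and>
     (\<forall>x. (\<lambda>y. b x y) summable_on UNIV) \<and> (\<forall>x. \<exists>y. b x y > 0)"

definition weighted_degree :: "('a \<Rightarrow> 'a \<Rightarrow> real) \<Rightarrow> 'a \<Rightarrow> real" where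
  "weighted_degree b x = (\<Sum>\<^sub>\<infinity>y. b x y)"

definition pseudo_metric :: "('a \<Rightarrow> 'a \<Rightarrow> real) \<Rightarrow> bool" where
  "pseudo_metric d \<longleftrightarrow>
     (\<forall>x y. d x y \<ge> 0) \<and> (\<forall>x. d x x = 0) \<and> (\<forall>x y. d x y = d y x) \<and>
     (\<forall>x y z. d x z \<le> d x y + d y z)"

definition intrinsic_metric :: "('a \<Rightarrow> 'a \<Rightarrow> real) \<Rightarrow> ('a \<Rightarrow> real) \<Rightarrow> ('a \<Rightarrow> 'a \<Rightarrow> real) \<Rightarrow> bool" where
  "intrinsic_metric b m d \<longleftrightarrow> pseudo_metric d \<and>
     (\<forall>x. (\<lambda>y. b x y * (d x y)\<^sup>2) summable_on UNIV \<and> (\<Sum>\<^sub>\<infinity>y. b x y * (d x y)\<^sup>2) \<le> m x)"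


subsection \<open>Isoperimetric constant\<close>

definition edge_boundary :: "('a \<Rightarrow> 'a \<Rightarrow> real) \<Rightarrow> 'a set \<Rightarrow> ('a \<times> 'a) set" where
  "edge_boundary b W = {(x, y). x \<in> W \<and> y \<notin> W \<and> b x y > 0}"

text \<open>
  For a graph with an intrinsic metric and finite \<open>W\<close> this sum converges, by the Cauchy--Schwarz
  inequality.
\<close>

definition boundary_area :: "('a \<Rightarrow> 'a \<Rightarrow> real) \<Rightarrow> ('a \<Rightarrow> 'a \<Rightarrow> real) \<Rightarrow> 'a set \<Rightarrow> real" where
  "boundary_area b d W = (\<Sum>\<^sub>\<infinity>(x, y)\<in>edge_boundary b W. b x y * d x y)"

definition isoperimetric_constant ::
  "('a \<Rightarrow> 'a \<Rightarrow> real) \<Rightarrow> ('a \<Rightarrow> real) \<Rightarrow> ('a \<Rightarrow> 'a \<Rightarrow> real) \<Rightarrow> 'a set \<Rightarrow> real" where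
  "isoperimetric_constant b m d U =
     (INF W \<in> {W. W \<subseteq> U \<and> finite W \<and> W \<noteq> {}}. boundary_area b d W / (\<Sum>x\<in>W. m x))"


subsection \<open>The Hilbert space, the form and the Laplacian\<close>

definition l2 :: "('a \<Rightarrow> real) \<Rightarrow> ('a \<Rightarrow> real) set" where
  "l2 m = {u. (\<lambda>x. (u x)\<^sup>2 * m x) summable_on UNIV}"

definition l2_inner :: "('a \<Rightarrow> real) \<Rightarrow> ('a \<Rightarrow> real) \<Rightarrow> ('a \<Rightarrow> real) \<Rightarrow> real" where
  "l2_inner m u v = (\<Sum>\<^sub>\<infinity>x. u x * v x * m x)"

definition l2_norm :: "('a \<Rightarrow> real) \<Rightarrow> ('a \<Rightarrow> real) \<Rightarrow> real" where
  "l2_norm m u = sqrt (l2_inner m u u)"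

definition finitely_supported :: "('a \<Rightarrow> real) set" where
  "finitely_supported = {u. finite {x. u x \<noteq> 0}}"

definition finite_energy :: "('a \<Rightarrow> 'a \<Rightarrow> real) \<Rightarrow> ('a \<Rightarrow> real) set" where
  "finite_energy b = {u. (\<lambda>(x, y). b x y * (u x - u y)\<^sup>2) summable_on UNIV}"

text \<open>The energy form \<open>Q\<close>, polarised; the quadratic form is \<open>Q(u) = Q(u, u)\<close>.\<close>

definition form_Q :: "('a \<Rightarrow> 'a \<Rightarrow> real) \<Rightarrow> ('a \<Rightarrow> real) \<Rightarrow> ('a \<Rightarrow> real) \<Rightarrow> real" where
  "form_Q b u v = (1/2) * (\<Sum>\<^sub>\<infinity>(x, y). b x y * ((u x - u y) * (v x - v y)))"

definition norm_Q :: "('a \<Rightarrow> 'a \<Rightarrow> real) \<Rightarrow> ('a \<Rightarrow> real) \<Rightarrow> ('a \<Rightarrow> real) \<Rightarrow> real" where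
  "norm_Q b m u = sqrt (form_Q b u u + (l2_norm m u)\<^sup>2)"

definition form_domain :: "('a \<Rightarrow> 'a \<Rightarrow> real) \<Rightarrow> ('a \<Rightarrow> real) \<Rightarrow> ('a \<Rightarrow> real) set" where
  "form_domain b m =
     {u \<in> l2 m \<inter> finite_energy b.
        \<forall>\<epsilon>>0. \<exists>\<phi>\<in>finitely_supported. norm_Q b m (\<lambda>x. u x - \<phi> x) < \<epsilon>}"

text \<open>
  The selfadjoint operator \<open>L\<close> associated with the closed form \<open>Q\<close> on \<open>form_domain b m\<close>:
  \<open>u \<in> D(L)\<close> and \<open>L u = f\<close> iff \<open>u \<in> D(Q)\<close>, \<open>f\<close> is square summable and
  \<open>Q(u, v) = \<langle>f, v\<rangle>\<close> for all \<open>v \<in> D(Q)\<close>. Such an \<open>f\<close> is unique, because \<open>D(Q)\<close> contains the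
  finitely supported functions.
\<close>

definition represents_form ::
  "('a \<Rightarrow> 'a \<Rightarrow> real) \<Rightarrow> ('a \<Rightarrow> real) \<Rightarrow> ('a \<Rightarrow> real) \<Rightarrow> ('a \<Rightarrow> real) \<Rightarrow> bool" where
  "represents_form b m u f \<longleftrightarrow> f \<in> l2 m \<and> (\<forall>v\<in>form_domain b m. form_Q b u v = l2_inner m f v)"

definition laplacian_domain :: "('a \<Rightarrow> 'a \<Rightarrow> real) \<Rightarrow> ('a \<Rightarrow> real) \<Rightarrow> ('a \<Rightarrow> real) set" where
  "laplacian_domain b m = {u \<in> form_domain b m. \<exists>f. represents_form b m u f}"

definition laplacian :: "('a \<Rightarrow> 'a \<Rightarrow> real) \<Rightarrow> ('a \<Rightarrow> real) \<Rightarrow> ('a \<Rightarrow> real) \<Rightarrow> ('a \<Rightarrow> real)" where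
  "laplacian b m u = (THE f. represents_form b m u f)"


subsection \<open>Spectrum\<close>

text \<open>
  The real spectrum of an operator \<open>T\<close> with domain \<open>A\<close> in \<open>l2 m\<close>. For a selfadjoint \<open>T\<close> it
  coincides with the spectrum of the complexification of \<open>T\<close>.
\<close>

definition resolvent_set ::
  "('a \<Rightarrow> real) \<Rightarrow> ('a \<Rightarrow> real) set \<Rightarrow> (('a \<Rightarrow> real) \<Rightarrow> ('a \<Rightarrow> real)) \<Rightarrow> real set" where
  "resolvent_set m A T =
     {s. bij_betw (\<lambda>u x. T u x - s * u x) A (l2 m) \<and>
          (\<exists>C. \<forall>u\<in>A. l2_norm m u \<le> C * l2_norm m (\<lambda>x. T u x - s * u x))}"

definition spectrum ::
  "('a \<Rightarrow> real) \<Rightarrow> ('a \<Rightarrow> real) set \<Rightarrow> (('a \<Rightarrow> real) \<Rightarrow> ('a \<Rightarrow> real)) \<Rightarrow> real set" where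
  "spectrum m A T = - resolvent_set m A T"

definition spectral_bottom :: "('a \<Rightarrow> 'a \<Rightarrow> real) \<Rightarrow> ('a \<Rightarrow> real) \<Rightarrow> real" where
  "spectral_bottom b m = Inf (spectrum m (laplacian_domain b m) (laplacian b m))"

end

theory Submission
  imports Defs
begin

text \<open>
  Since \<open>m\<close> dominates the weighted degree, \<open>Q(u) \<le> 2 \<parallel>u\<parallel>\<^sup>2\<close>.  Hence the form domain is all of
  \<open>\<ell>\<^sup>2(X, m)\<close>, and \<open>L\<close> is the bounded symmetric operator
  \<open>L u(x) = (1/m(x)) \<Sum>\<^sub>y b(x,y) (u(x) - u(y))\<close>.  Two things remain: a lower bound on the quadratic form,
  and the passage from the form to the spectrum.

  The lower bound is a Cheeger inequality.  Both hypotheses on \<open>d\<close> yield an edge length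
  \<open>\<rho>\<close>, at least \<open>max(d, 1)\<close> along edges, with \<open>\<Sum>\<^sub>y b(x,y) \<rho>(x,y)\<^sup>2 \<le> m(x)\<close>: take
  \<open>\<rho> = d\<close> if \<open>d \<ge> 1\<close> along edges, and \<open>\<rho> = 1\<close> if
  \<open>d \<le> 1\<close>.  Let \<open>u\<close> be finitely supported, \<open>N = \<parallel>u\<parallel>\<^sup>2\<close> and \<open>Q = Q(u)\<close>.  Decomposing \<open>u\<^sup>2\<close> into indicators of
  its superlevel sets (\<open>isoperimetric_inequality\<close>) and applying the Cauchy--Schwarz inequality gives
  \<open>2 \<alpha> N \<le> \<Sum> b d |u(x)\<^sup>2 - u(y)\<^sup>2| \<le> (\<Sum> b (u(x) - u(y))\<^sup>2)\<^sup>1\<^sup>/\<^sup>2 (\<Sum> b \<rho>\<^sup>2 (u(x) + u(y))\<^sup>2)\<^sup>1\<^sup>/\<^sup>2\<close>.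
  The first factor is \<open>(2Q)\<^sup>1\<^sup>/\<^sup>2\<close>.  By the parallelogram law, the sum in the second is at most \<open>4N\<close> minus
  \<open>\<Sum> b \<rho>\<^sup>2 (u(x) - u(y))\<^sup>2\<close>, hence at most \<open>4N - 2Q\<close> because \<open>\<rho> \<ge> 1\<close>.  Therefore \<open>\<alpha>\<^sup>2 N\<^sup>2 \<le> Q (2N - Q)\<close>
  (\<open>Cheeger_quadratic\<close>), that is, \<open>(N - Q)\<^sup>2 \<le> (1 - \<alpha>\<^sup>2) N\<^sup>2\<close>, and so \<open>Q \<ge> (1 - sqrt(1 - \<alpha>\<^sup>2)) N\<close>.  By density this
  extends to all of \<open>\<ell>\<^sup>2(X, m)\<close>.

  For the spectrum (\<open>spectral_bottom_ge\<close>), suppose that \<open>Q(u) \<ge> r \<parallel>u\<parallel>\<^sup>2\<close> for all \<open>u\<close>.  If \<open>s < r\<close>, then \<open>L - s\<close> is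
  bounded and coercive, hence boundedly invertible (\<open>coercive_imp_bij\<close>), so no such \<open>s\<close> is spectral.
  The bottom of the spectrum is an infimum of reals, so the spectrum must also be shown to be
  nonempty: it contains the infimum of the Rayleigh quotients (\<open>not_bounded_below_at_Rayleigh_Inf\<close>).
  These facts are proved for operators on an abstract Hilbert space and carried over to
  \<open>\<ell>\<^sup>2(X, m)\<close> along the isometry \<open>u \<mapsto> m\<^sup>1\<^sup>/\<^sup>2 u\<close> onto unweighted \<open>\<ell>\<^sup>2\<close>.
\<close>

section \<open>The Hilbert space of square summable functions\<close>

lemma square_summable_mult:
  fixes f g :: "'i \<Rightarrow> real"
  assumes "(\<lambda>i. (f i)\<^sup>2) summable_on A" and "(\<lambda>i. (g i)\<^sup>2) summable_on A"
  shows "(\<lambda>i. f i * g i) summable_on A"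
proof -
  have "(\<lambda>i. (f i)\<^sup>2 + (g i)\<^sup>2) summable_on A"
    using assms by (rule summable_on_add)
  then have "(\<lambda>i. norm (f i * g i)) summable_on A"
  proof (rule summable_on_comparison_test)
    fix i
    have "0 \<le> (\<bar>f i\<bar> - \<bar>g i\<bar>)\<^sup>2" "0 \<le> \<bar>f i\<bar> * \<bar>g i\<bar>"
      by simp_all
    then show "norm (f i * g i) \<le> (f i)\<^sup>2 + (g i)\<^sup>2"
      unfolding real_norm_def abs_mult power2_diff power2_abs by linarith
  qed simp
  then show ?thesis
    by (rule abs_summable_summable)
qed

lemma square_summable_add:
  fixes f g :: "'i \<Rightarrow> real"
  assumes "(\<lambda>i. (f i)\<^sup>2) summable_on A" and "(\<lambda>i. (g i)\<^sup>2) summable_on A"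
  shows "(\<lambda>i. (f i + g i)\<^sup>2) summable_on A"
proof -
  have "(\<lambda>i. ((f i)\<^sup>2 + (g i)\<^sup>2) + 2 * (f i * g i)) summable_on A"
    using assms by (intro summable_on_add summable_on_cmult_right square_summable_mult)
  then show ?thesis
    by (simp add: power2_sum mult.assoc)
qed

text \<open>
  The unweighted space is made a type of class \<open>real_inner\<close>.  It then comes with the norm, the
  Cauchy--Schwarz inequality and the fixed point theorem, and it can be indexed by vertices as well as by
  pairs of vertices.
\<close>

typedef 'i square_summable = "{f :: 'i \<Rightarrow> real. (\<lambda>i. (f i)\<^sup>2) summable_on UNIV}"
  morphisms coeff Square_summable
  by (rule exI[of _ "\<lambda>_. 0"]) simp

setup_lifting type_definition_square_summable

lemma summable_coeff: "(\<lambda>i. (coeff x i)\<^sup>2) summable_on UNIV"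
  using coeff[of x] by simp

instantiation square_summable :: (type) real_inner
begin

lift_definition zero_square_summable :: "'a square_summable" is "\<lambda>_. 0"
  by simp

lift_definition plus_square_summable ::
  "'a square_summable \<Rightarrow> 'a square_summable \<Rightarrow> 'a square_summable" is "\<lambda>f g i. f i + g i"
  by (rule square_summable_add)

lift_definition uminus_square_summable :: "'a square_summable \<Rightarrow> 'a square_summable"
  is "\<lambda>f i. - f i"
  by simp

lift_definition minus_square_summable ::
  "'a square_summable \<Rightarrow> 'a square_summable \<Rightarrow> 'a square_summable" is "\<lambda>f g i. f i - g i"
  subgoal for f g
    using square_summable_add[of f UNIV "\<lambda>i. - g i"] by simp
  done

lift_definition scaleR_square_summable :: "real \<Rightarrow> 'a square_summable \<Rightarrow> 'a square_summable"
  is "\<lambda>c f i. c * f i"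
  by (simp add: power_mult_distrib summable_on_cmult_right)

lift_definition inner_square_summable :: "'a square_summable \<Rightarrow> 'a square_summable \<Rightarrow> real"
  is "\<lambda>f g. \<Sum>\<^sub>\<infinity>i. f i * g i" .

definition norm_square_summable :: "'a square_summable \<Rightarrow> real" where
  "norm (x :: 'a square_summable) = sqrt (inner x x)"

definition sgn_square_summable :: "'a square_summable \<Rightarrow> 'a square_summable" where
  "sgn (x :: 'a square_summable) = inverse (norm x) *\<^sub>R x"

definition dist_square_summable :: "'a square_summable \<Rightarrow> 'a square_summable \<Rightarrow> real" where
  "dist (x :: 'a square_summable) y = norm (x - y)"

definition uniformity_square_summable :: "('a square_summable \<times> 'a square_summable) filter" where
  "uniformity = (INF e\<in>{0<..}. principal {(x, y). dist x (y :: 'a square_summable) < e})"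

definition open_square_summable :: "'a square_summable set \<Rightarrow> bool" where
  "open (U :: 'a square_summable set) \<longleftrightarrow>
    (\<forall>x\<in>U. eventually (\<lambda>(x', y). x' = x \<longrightarrow> y \<in> U) uniformity)"

instance
proof
  fix x y z :: "'a square_summable" and r s :: real
  show "x + y + z = x + (y + z)" "x + y = y + x" "0 + x = x" "- x + x = 0" "x - y = x + - y"
    "r *\<^sub>R (x + y) = r *\<^sub>R x + r *\<^sub>R y" "(r + s) *\<^sub>R x = r *\<^sub>R x + s *\<^sub>R x"
    "r *\<^sub>R s *\<^sub>R x = (r * s) *\<^sub>R x" "1 *\<^sub>R x = x"
    by (transfer; simp add: algebra_simps)+
  show "sgn x = inverse (norm x) *\<^sub>R x" "dist x y = norm (x - y)"
    by (simp_all add: sgn_square_summable_def dist_square_summable_def)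
  show "uniformity = (INF e\<in>{0<..}. principal {(x, y). dist x (y :: 'a square_summable) < e})"
    by (simp add: uniformity_square_summable_def)
  show "open U \<longleftrightarrow> (\<forall>x\<in>U. eventually (\<lambda>(x', y). x' = x \<longrightarrow> y \<in> U) uniformity)"
    for U :: "'a square_summable set"
    by (simp add: open_square_summable_def)
  show "inner x y = inner y x"
    by transfer (simp add: mult.commute)
  show "inner (x + y) z = inner x z + inner y z"
    by transfer (simp add: distrib_right infsum_add square_summable_mult)
  show "inner (r *\<^sub>R x) y = r * inner x y"
    by transfer (simp add: mult.assoc infsum_cmult_right')
  show "0 \<le> inner x x"
    by transfer (simp add: infsum_nonneg)
  show "inner x x = 0 \<longleftrightarrow> x = 0"
  proof (transfer, rule iffI)
    fix f :: "'a \<Rightarrow> real"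
    assume f: "(\<lambda>i. (f i)\<^sup>2) summable_on UNIV" and "(\<Sum>\<^sub>\<infinity>i. f i * f i) = 0"
    then have "f i * f i = 0" for i
      by (intro nonneg_infsum_le_0D[of "\<lambda>i. f i * f i" UNIV i]) (auto simp: power2_eq_square)
    then show "f = (\<lambda>_. 0)"
      by auto
  qed simp
  show "norm x = sqrt (inner x x)"
    by (simp add: norm_square_summable_def)
qed

end

lemma inner_coeff: "inner x y = (\<Sum>\<^sub>\<infinity>i. coeff x i * coeff y i)"
  by transfer simp

lemma norm_coeff: "(norm x)\<^sup>2 = (\<Sum>\<^sub>\<infinity>i. (coeff x i)\<^sup>2)"
  unfolding power2_norm_eq_inner inner_coeff by (simp add: power2_eq_square)

lemma coeff_diff: "coeff (x - y) i = coeff x i - coeff y i"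
  by transfer simp

lemma coeff_scaleR: "coeff (c *\<^sub>R x) i = c * coeff x i"
  by transfer simp

lemma coeff_Square_summable:
  assumes "(\<lambda>i. (f i)\<^sup>2) summable_on UNIV"
  shows "coeff (Square_summable f) = f"
  using assms by (simp add: Square_summable_inverse)

lemma infsum_Cauchy_Schwarz:
  fixes f g :: "'i \<Rightarrow> real"
  assumes "(\<lambda>i. (f i)\<^sup>2) summable_on UNIV" and "(\<lambda>i. (g i)\<^sup>2) summable_on UNIV"
  shows "(\<Sum>\<^sub>\<infinity>i. f i * g i)\<^sup>2 \<le> (\<Sum>\<^sub>\<infinity>i. (f i)\<^sup>2) * (\<Sum>\<^sub>\<infinity>i. (g i)\<^sup>2)"
  using Cauchy_Schwarz_ineq[of "Square_summable f" "Square_summable g"] assms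
  by (simp add: inner_coeff coeff_Square_summable power2_eq_square)

lemma sum_coeff_le_norm:
  assumes "finite F"
  shows "(\<Sum>i\<in>F. (coeff x i)\<^sup>2) \<le> (norm x)\<^sup>2"
  unfolding norm_coeff by (rule finite_sum_le_infsum) (auto simp: summable_coeff assms)

lemma coeff_le_norm: "\<bar>coeff x i\<bar> \<le> norm x"
  using sum_coeff_le_norm[of "{i}" x] by (simp flip: abs_le_square_iff)

text \<open>
  Coordinates are \<open>1\<close>-Lipschitz, so a Cauchy sequence has a coordinatewise limit.  Fatou's argument,
  carried out on finite index sets, shows that the convergence is in norm.
\<close>

instance square_summable :: (type) complete_space
proof
  fix X :: "nat \<Rightarrow> 'a square_summable"
  assume X: "Cauchy X"
  have "Cauchy (\<lambda>n. coeff (X n) i)" for i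
  proof (rule CauchyI)
    fix e :: real
    assume "0 < e"
    then obtain M where "\<forall>m\<ge>M. \<forall>n\<ge>M. norm (X m - X n) < e"
      using X CauchyD by blast
    then show "\<exists>M. \<forall>m\<ge>M. \<forall>n\<ge>M. norm (coeff (X m) i - coeff (X n) i) < e"
      by (metis coeff_diff coeff_le_norm le_less_trans real_norm_def)
  qed
  then have "\<exists>l. (\<lambda>n. coeff (X n) i) \<longlonglongrightarrow> l" for i
    by (simp add: Cauchy_convergent_iff convergent_def)
  then obtain f where f: "\<And>i. (\<lambda>n. coeff (X n) i) \<longlonglongrightarrow> f i"
    by metis
  \<comment> \<open>The estimate holds for all finite \<open>F\<close> with the same \<open>M\<close>, hence for the whole sum.\<close>
  have limit: "\<exists>M. \<forall>n\<ge>M. \<forall>F. finite F \<longrightarrow> (\<Sum>i\<in>F. (coeff (X n) i - f i)\<^sup>2) \<le> e\<^sup>2" if "0 < e" for e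
  proof -
    obtain M where M: "\<And>m n. M \<le> m \<Longrightarrow> M \<le> n \<Longrightarrow> norm (X n - X m) < e"
      using CauchyD[OF X \<open>0 < e\<close>] by blast
    have "(\<Sum>i\<in>F. (coeff (X n) i - f i)\<^sup>2) \<le> e\<^sup>2" if "M \<le> n" "finite F" for n F
    proof (rule LIMSEQ_le_const2)
      show "(\<lambda>m. \<Sum>i\<in>F. (coeff (X n) i - coeff (X m) i)\<^sup>2) \<longlonglongrightarrow> (\<Sum>i\<in>F. (coeff (X n) i - f i)\<^sup>2)"
        by (intro tendsto_intros f)
      have "(\<Sum>i\<in>F. (coeff (X n) i - coeff (X m) i)\<^sup>2) \<le> e\<^sup>2" if "M \<le> m" for m
      proof -
        have "(\<Sum>i\<in>F. (coeff (X n) i - coeff (X m) i)\<^sup>2) \<le> (norm (X n - X m))\<^sup>2"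
          using sum_coeff_le_norm[OF \<open>finite F\<close>, of "X n - X m"] by (simp add: coeff_diff)
        also have "\<dots> \<le> e\<^sup>2"
          using M[OF that \<open>M \<le> n\<close>] by (intro power_mono) auto
        finally show ?thesis .
      qed
      then show "\<exists>N. \<forall>m\<ge>N. (\<Sum>i\<in>F. (coeff (X n) i - coeff (X m) i)\<^sup>2) \<le> e\<^sup>2"
        by blast
    qed
    then show ?thesis
      by blast
  qed
  have diff_summable: "(\<lambda>i. (coeff (X n) i - f i)\<^sup>2) summable_on UNIV"
    if "\<And>F. finite F \<Longrightarrow> (\<Sum>i\<in>F. (coeff (X n) i - f i)\<^sup>2) \<le> c" for n c
    using that by (intro nonneg_bdd_above_summable_on bdd_aboveI2[where M = c]) auto
  obtain M where "\<And>F. finite F \<Longrightarrow> (\<Sum>i\<in>F. (coeff (X M) i - f i)\<^sup>2) \<le> 1"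
    using limit[of 1] by auto
  then have "(\<lambda>i. (coeff (X M) i - f i)\<^sup>2) summable_on UNIV"
    by (rule diff_summable)
  then have "(\<lambda>i. (f i - coeff (X M) i)\<^sup>2) summable_on UNIV"
    by (simp add: power2_commute)
  from square_summable_add[OF this summable_coeff[of "X M"]]
  have coeff_limit: "coeff (Square_summable f) = f"
    by (intro coeff_Square_summable) simp
  have "X \<longlonglongrightarrow> Square_summable f"
  proof (rule LIMSEQ_I)
    fix e :: real
    assume "0 < e"
    then obtain M where M: "\<And>n F. M \<le> n \<Longrightarrow> finite F \<Longrightarrow> (\<Sum>i\<in>F. (coeff (X n) i - f i)\<^sup>2) \<le> (e/2)\<^sup>2"
      using limit[of "e/2"] half_gt_zero[OF \<open>0 < e\<close>] by blast
    have "norm (X n - Square_summable f) < e" if "M \<le> n" for n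
    proof -
      have "(norm (X n - Square_summable f))\<^sup>2 \<le> (e/2)\<^sup>2"
        unfolding norm_coeff coeff_diff coeff_limit
        by (intro infsum_le_finite_sums diff_summable[OF M] M that)
      then have "norm (X n - Square_summable f) \<le> e/2"
        by (rule power2_le_imp_le) (use \<open>0 < e\<close> in simp)
      then show ?thesis
        using \<open>0 < e\<close> by simp
    qed
    then show "\<exists>M. \<forall>n\<ge>M. norm (X n - Square_summable f) < e"
      by blast
  qed
  then show "convergent X"
    by (auto simp: convergent_def)
qed

lemma finite_support_dense:
  assumes "0 < e"
  obtains y where "finite {i. coeff y i \<noteq> 0}" and "norm (x - y) < e"
proof -
  have "0 < (e/2)\<^sup>2"
    using assms by simp
  then obtain F where F: "finite F" "dist (\<Sum>i\<in>F. (coeff x i)\<^sup>2) (\<Sum>\<^sub>\<infinity>i. (coeff x i)\<^sup>2) \<le> (e/2)\<^sup>2"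
    using infsum_finite_approximation[OF summable_coeff[of x] \<open>0 < (e/2)\<^sup>2\<close>] by blast
  define f where "f i = (if i \<in> F then coeff x i else 0)" for i
  have "(\<lambda>i. (f i)\<^sup>2) summable_on UNIV \<longleftrightarrow> (\<lambda>i. (coeff x i)\<^sup>2) summable_on F"
    by (rule summable_on_cong_neutral) (auto simp: f_def)
  with F have y: "coeff (Square_summable f) = f"
    by (intro coeff_Square_summable) simp
  have "(norm (x - Square_summable f))\<^sup>2 = (\<Sum>\<^sub>\<infinity>i\<in>- F. (coeff x i)\<^sup>2)"
    unfolding norm_coeff coeff_diff y by (rule infsum_cong_neutral) (auto simp: f_def)
  also have "\<dots> = (\<Sum>\<^sub>\<infinity>i. (coeff x i)\<^sup>2) - (\<Sum>i\<in>F. (coeff x i)\<^sup>2)"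
    using infsum_Diff[OF summable_coeff[of x], of F] F by (simp add: Compl_eq_Diff_UNIV)
  also have "\<dots> \<le> (e/2)\<^sup>2"
    using F by (simp add: dist_real_def abs_le_iff)
  finally have "norm (x - Square_summable f) \<le> e/2"
    by (rule power2_le_imp_le) (use assms in simp)
  then have "norm (x - Square_summable f) < e"
    using assms by simp
  moreover have "finite {i. coeff (Square_summable f) i \<noteq> 0}"
    using F by (auto simp: y f_def intro: finite_subset)
  ultimately show ?thesis
    using that by blast
qed

section \<open>Bounded operators on a Hilbert space\<close>

lemma coercive_imp_bounded_below:
  fixes T :: "'h::real_inner \<Rightarrow> 'h"
  assumes "0 < c" and coercive: "\<And>v. c * (norm v)\<^sup>2 \<le> inner (T v) v"
  shows "norm v \<le> (1 / c) * norm (T v)"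
proof (cases "v = 0")
  case False
  have "c * norm v * norm v \<le> norm (T v) * norm v"
    using order_trans[OF coercive norm_cauchy_schwarz] by (simp add: power2_eq_square mult.assoc)
  then have "c * norm v \<le> norm (T v)"
    using False by simp
  then show ?thesis
    using \<open>0 < c\<close> by (simp add: field_simps)
qed (use \<open>0 < c\<close> in simp)

text \<open>
  Lax--Milgram for a bounded form: \<open>u \<mapsto> u - t (T u - f)\<close> is a contraction for small \<open>t\<close>, because
  \<open>|v - t T v|\<^sup>2 \<le> (1 - 2 t c + t\<^sup>2 K\<^sup>2) |v|\<^sup>2\<close>, and its fixed point solves \<open>T u = f\<close>.
\<close>

lemma coercive_imp_bij:
  fixes T :: "'h::{real_inner, complete_space} \<Rightarrow> 'h"
  assumes "bounded_linear T" and "0 < c"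
    and coercive: "\<And>v. c * (norm v)\<^sup>2 \<le> inner (T v) v"
  shows "bij T"
proof -
  interpret T: bounded_linear T by fact
  obtain K where K: "0 < K" "\<And>v. norm (T v) \<le> norm v * K"
    using T.pos_bounded by blast
  \<comment> \<open>This \<open>t\<close> minimises \<open>1 - 2 t c + t\<^sup>2 K\<^sup>2\<close>.  The minimum is negative if \<open>c > K\<close>, which can only occur on the
    zero space; hence the truncation in \<open>q\<close>.\<close>
  define t where "t = c / K\<^sup>2"
  define q where "q = sqrt (max 0 (1 - c\<^sup>2 / K\<^sup>2))"
  have q: "0 \<le> q" "q < 1"
    using \<open>0 < c\<close> K(1) by (auto simp: q_def max_def)
  have contraction: "norm (v - t *\<^sub>R T v) \<le> q * norm v" for v
  proof -
    have "(norm (v - t *\<^sub>R T v))\<^sup>2 = (norm v)\<^sup>2 - 2 * t * inner (T v) v + t\<^sup>2 * (norm (T v))\<^sup>2"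
      unfolding power2_norm_eq_inner by (simp add: algebra_simps inner_commute power2_eq_square)
    also have "\<dots> \<le> (norm v)\<^sup>2 - 2 * t * (c * (norm v)\<^sup>2) + t\<^sup>2 * (norm v * K)\<^sup>2"
      using \<open>0 < c\<close> K
      by (intro add_mono diff_mono mult_left_mono power_mono coercive) (auto simp: t_def)
    also have "\<dots> = (1 - c\<^sup>2 / K\<^sup>2) * (norm v)\<^sup>2"
      using K(1) by (simp add: t_def field_simps power2_eq_square)
    also have "\<dots> \<le> (q * norm v)\<^sup>2"
      by (auto simp: q_def power_mult_distrib intro: mult_right_mono)
    finally show ?thesis
      by (rule power2_le_imp_le) (use q(1) in simp)
  qed
  have "\<exists>!u. T u = f" for f
  proof -
    have "\<exists>!u. u - t *\<^sub>R (T u - f) = u"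
    proof (rule banach_fix_type[OF q], intro allI)
      fix u v
      have "dist (u - t *\<^sub>R (T u - f)) (v - t *\<^sub>R (T v - f)) = norm ((u - v) - t *\<^sub>R T (u - v))"
        by (simp add: dist_norm T.diff algebra_simps)
      also have "\<dots> \<le> q * dist u v"
        using contraction by (simp add: dist_norm)
      finally show "dist (u - t *\<^sub>R (T u - f)) (v - t *\<^sub>R (T v - f)) \<le> q * dist u v" .
    qed
    moreover have "t \<noteq> 0"
      using \<open>0 < c\<close> K by (simp add: t_def)
    ultimately show ?thesis
      by simp
  qed
  then show ?thesis
    by (metis bijI')
qed

text \<open>
  Positivity of \<open>\<langle>T w, w\<rangle>\<close> at \<open>w = v - T v / K\<close> gives \<open>|T v|\<^sup>2 \<le> K \<langle>T v, v\<rangle>\<close> whenever \<open>K\<close> bounds the norm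
  of \<open>T\<close>.  A vector that nearly minimises the form is therefore nearly annihilated by \<open>T\<close>.
\<close>

lemma nonneg_selfadjoint_norm_le:
  fixes T :: "'h::real_inner \<Rightarrow> 'h"
  assumes "linear T" and "0 < K" and bound: "\<And>v. norm (T v) \<le> norm v * K"
    and sym: "\<And>u v. inner (T u) v = inner u (T v)" and nonneg: "\<And>v. 0 \<le> inner (T v) v"
  shows "(norm (T v))\<^sup>2 \<le> K * inner (T v) v"
proof -
  interpret linear T by fact
  let ?w = "v - (1 / K) *\<^sub>R T v"
  have "inner (T (T v)) (T v) \<le> norm (T (T v)) * norm (T v)"
    by (rule norm_cauchy_schwarz)
  also have "\<dots> \<le> norm (T v) * K * norm (T v)"
    by (intro mult_right_mono bound) simp
  finally have TT: "inner (T (T v)) (T v) \<le> K * (norm (T v))\<^sup>2"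
    by (simp add: power2_eq_square algebra_simps)
  have "0 \<le> inner (T ?w) ?w"
    by (rule nonneg)
  also have "\<dots> = inner (T v) v - 2 / K * (norm (T v))\<^sup>2 + inner (T (T v)) (T v) / K\<^sup>2"
    using sym[of "T v" v]
    unfolding power2_norm_eq_inner
    by (simp add: diff scaleR inner_diff_left inner_diff_right power2_eq_square diff_divide_distrib)
  also have "\<dots> \<le> inner (T v) v - 2 / K * (norm (T v))\<^sup>2 + (K * (norm (T v))\<^sup>2) / K\<^sup>2"
    using TT by (intro add_mono divide_right_mono) auto
  also have "\<dots> = inner (T v) v - (norm (T v))\<^sup>2 / K"
    using \<open>0 < K\<close> by (simp add: power2_eq_square field_simps)
  finally show ?thesis
    using \<open>0 < K\<close> by (simp add: field_simps)
qed

text \<open>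
  For the infimum \<open>r\<close> of the Rayleigh quotients, \<open>T - r\<close> is nonnegative and its form takes arbitrarily small values
  on unit vectors.  By the preceding estimate \<open>T - r\<close> itself takes arbitrarily small values there.
\<close>

lemma not_bounded_below_at_Rayleigh_Inf:
  fixes T :: "'h::real_inner \<Rightarrow> 'h"
  assumes "bounded_linear T" and sym: "\<And>u v. inner (T u) v = inner u (T v)"
    and "v0 \<noteq> (0 :: 'h)"
  obtains r where "\<nexists>C. \<forall>v. norm v \<le> C * norm (T v - r *\<^sub>R v)"
proof -
  interpret T: bounded_linear T by fact
  define R where "R = {inner (T v) v | v. norm v = 1}"
  define r where "r = Inf R"
  obtain K where K: "0 < K" "\<And>v. norm (T v) \<le> norm v * K"
    using T.pos_bounded by blast
  have "norm (v0 /\<^sub>R norm v0) = 1"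
    using \<open>v0 \<noteq> 0\<close> by simp
  then have "R \<noteq> {}"
    unfolding R_def by blast
  have "bdd_below R"
  proof (rule bdd_belowI[of _ "- K"])
    fix a
    assume "a \<in> R"
    then obtain v where "a = inner (T v) v" "norm v = 1"
      by (auto simp: R_def)
    then show "- K \<le> a"
      using Cauchy_Schwarz_ineq2[of "T v" v] K(2)[of v] by simp
  qed
  define S where "S v = T v - r *\<^sub>R v" for v
  have S: "bounded_linear S"
    unfolding S_def
    by (intro bounded_linear_sub \<open>bounded_linear T\<close> bounded_linear_scaleR_right)
  have S_nonneg: "0 \<le> inner (S v) v" for v
  proof (cases "v = 0")
    case False
    have "norm (v /\<^sub>R norm v) = 1"
      using False by simp
    then have "inner (T (v /\<^sub>R norm v)) (v /\<^sub>R norm v) \<in> R"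
      unfolding R_def by blast
    then have "r \<le> inner (T (v /\<^sub>R norm v)) (v /\<^sub>R norm v)"
      unfolding r_def using \<open>bdd_below R\<close> by (rule cInf_lower)
    then have "r * (norm v)\<^sup>2 \<le> inner (T v) v"
      using False by (simp add: T.scaleR field_simps power2_eq_square)
    then show ?thesis
      by (simp add: S_def inner_diff_left power2_norm_eq_inner)
  qed (simp add: S_def)
  have S_sym: "inner (S u) v = inner u (S v)" for u v
    by (simp add: S_def inner_diff_left inner_diff_right sym)
  obtain K' where K': "0 < K'" "\<And>v. norm (S v) \<le> norm v * K'"
    using bounded_linear.pos_bounded[OF S] by blast
  have "\<nexists>C. \<forall>v. norm v \<le> C * norm (S v)"
  proof
    assume "\<exists>C. \<forall>v. norm v \<le> C * norm (S v)"
    then obtain C where C: "\<And>v. norm v \<le> C * norm (S v)"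
      by blast
    have "0 < C"
    proof (rule ccontr)
      assume "\<not> 0 < C"
      then have "norm v0 \<le> 0"
        using C[of v0] by (meson mult_nonpos_nonneg norm_ge_zero order_trans not_less)
      with \<open>v0 \<noteq> 0\<close> show False
        by simp
    qed
    then have "0 < 1 / (C\<^sup>2 * K')"
      using K'(1) by simp
    then obtain a where "a \<in> R" "a < r + 1 / (C\<^sup>2 * K')"
      using cInf_lessD[OF \<open>R \<noteq> {}\<close>, of "r + 1 / (C\<^sup>2 * K')"] by (auto simp: r_def)
    then obtain v where v: "norm v = 1" "inner (T v) v < r + 1 / (C\<^sup>2 * K')"
      by (auto simp: R_def)
    then have Sv: "inner (S v) v < 1 / (C\<^sup>2 * K')"
      by (simp add: S_def inner_diff_left flip: power2_norm_eq_inner)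
    have "1 \<le> (C * norm (S v))\<^sup>2"
      using C[of v] v(1) by (simp add: one_le_power)
    also have "\<dots> \<le> C\<^sup>2 * (K' * inner (S v) v)"
      unfolding power_mult_distrib
      by (intro mult_left_mono nonneg_selfadjoint_norm_le bounded_linear.linear[OF S] K' S_sym S_nonneg)
        simp
    also have "\<dots> < 1"
      using Sv K'(1) \<open>0 < C\<close> by (simp add: field_simps)
    finally show False
      by simp
  qed
  then show ?thesis
    using that by (simp add: S_def)
qed


section \<open>Edge weights with bounded degree\<close>

lemma summable_on_swap_pair:
  "(\<lambda>(x, y). f y x) summable_on UNIV \<longleftrightarrow> (\<lambda>(x, y). f x y) summable_on UNIV"
  using summable_on_swap[of "\<lambda>(x, y). f x y" UNIV UNIV] by (simp add: case_prod_unfold)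

lemma infsum_swap_pair:
  fixes f :: "'i \<Rightarrow> 'j \<Rightarrow> real"
  shows "(\<Sum>\<^sub>\<infinity>(x, y). f y x) = (\<Sum>\<^sub>\<infinity>(x, y). f x y)"
  using infsum_reindex_bij_betw[of prod.swap UNIV UNIV "\<lambda>(x, y). f x y"]
  by (simp add: case_prod_unfold)

lemma summable_on_pair_row:
  fixes f :: "'i \<Rightarrow> 'j \<Rightarrow> real"
  assumes "(\<lambda>(x, y). f x y) summable_on UNIV"
  shows "(\<lambda>y. f x y) summable_on UNIV"
  using summable_on_SigmaD1[of f UNIV "\<lambda>_. UNIV" x] assms by simp

lemma summable_on_row_sums:
  fixes f :: "'i \<Rightarrow> 'j \<Rightarrow> real"
  assumes "(\<lambda>(x, y). f x y) summable_on UNIV"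
  shows "(\<lambda>x. \<Sum>\<^sub>\<infinity>y. f x y) summable_on UNIV"
  using summable_on_Sigma_banach[of f UNIV "\<lambda>_. UNIV"] assms by simp

lemma infsum_row_sums:
  fixes f :: "'i \<Rightarrow> 'j \<Rightarrow> real"
  assumes "(\<lambda>(x, y). f x y) summable_on UNIV"
  shows "(\<Sum>\<^sub>\<infinity>x. \<Sum>\<^sub>\<infinity>y. f x y) = (\<Sum>\<^sub>\<infinity>(x, y). f x y)"
  using infsum_Sigma'_banach[of f UNIV "\<lambda>_. UNIV"] assms by simp

lemma summable_on_abs_comparison:
  fixes f g :: "'i \<Rightarrow> real"
  assumes "g summable_on A" and "\<And>i. i \<in> A \<Longrightarrow> \<bar>f i\<bar> \<le> g i"
  shows "f summable_on A"
  by (rule abs_summable_summable, rule summable_on_comparison_test[OF assms(1)]) (use assms in auto)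

text \<open>
  Three weights are used on the same space: \<open>b\<close>, which gives the form; \<open>b d\<close>, which measures boundaries; and
  \<open>b \<rho>\<^sup>2\<close> for an edge length \<open>\<rho>\<close>.  All have degree at most \<open>m\<close>, which is what makes the double sums below
  converge for square summable \<open>u\<close>.
\<close>

locale edge_weight =
  fixes w :: "'a \<Rightarrow> 'a \<Rightarrow> real" and m :: "'a \<Rightarrow> real"
  assumes nonneg: "0 \<le> w x y" and sym: "w x y = w y x"
    and summable_row: "(\<lambda>y. w x y) summable_on UNIV"
    and degree_le: "(\<Sum>\<^sub>\<infinity>y. w x y) \<le> m x"
    and mass_pos: "0 < m x"
begin

lemma fst_summable_and_le:
  assumes "u \<in> l2 m"
  shows "(\<lambda>(x, y). w x y * (u x)\<^sup>2) summable_on UNIV"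
    and "(\<Sum>\<^sub>\<infinity>(x, y). w x y * (u x)\<^sup>2) \<le> l2_inner m u u"
proof -
  have u: "(\<lambda>x. (u x)\<^sup>2 * m x) summable_on UNIV"
    using assms by (simp add: l2_def)
  have le: "(\<Sum>\<^sub>\<infinity>y. w x y) * (u x)\<^sup>2 \<le> (u x)\<^sup>2 * m x" for x
    using mult_right_mono[OF degree_le, of "(u x)\<^sup>2" x] by (simp add: mult.commute)
  have rows: "(\<lambda>x. (\<Sum>\<^sub>\<infinity>y. w x y) * (u x)\<^sup>2) summable_on UNIV"
    by (rule summable_on_comparison_test[OF u]) (auto intro: le simp: infsum_nonneg nonneg)
  have "(\<lambda>(x, y). w x y * (u x)\<^sup>2) summable_on UNIV \<times> UNIV"
  proof (rule summable_on_SigmaI)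
    show "((\<lambda>y. case (x, y) of (x, y) \<Rightarrow> w x y * (u x)\<^sup>2) has_sum
        (\<Sum>\<^sub>\<infinity>y. w x y) * (u x)\<^sup>2) UNIV" for x
      by (simp add: has_sum_cmult_left summable_row)
  qed (use rows nonneg in auto)
  then show *: "(\<lambda>(x, y). w x y * (u x)\<^sup>2) summable_on UNIV"
    by simp
  have "(\<Sum>\<^sub>\<infinity>(x, y). w x y * (u x)\<^sup>2) = (\<Sum>\<^sub>\<infinity>x. (\<Sum>\<^sub>\<infinity>y. w x y) * (u x)\<^sup>2)"
    by (simp add: infsum_cmult_left' flip: infsum_row_sums[OF *])
  also have "\<dots> \<le> (\<Sum>\<^sub>\<infinity>x. (u x)\<^sup>2 * m x)"
    by (rule infsum_mono[OF rows u le])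
  finally show "(\<Sum>\<^sub>\<infinity>(x, y). w x y * (u x)\<^sup>2) \<le> l2_inner m u u"
    by (simp add: l2_inner_def power2_eq_square)
qed

lemma snd_summable:
  assumes "u \<in> l2 m"
  shows "(\<lambda>(x, y). w x y * (u y)\<^sup>2) summable_on UNIV"
  using fst_summable_and_le(1)[OF assms] summable_on_swap_pair[of "\<lambda>x y. w x y * (u x)\<^sup>2"]
  by (simp add: sym)

lemma infsum_snd:
  "(\<Sum>\<^sub>\<infinity>(x, y). w x y * (u y)\<^sup>2) = (\<Sum>\<^sub>\<infinity>(x, y). w x y * (u x)\<^sup>2)"
  using infsum_swap_pair[of "\<lambda>x y. w x y * (u x)\<^sup>2"] by (simp add: sym)

lemma ends_summable:
  assumes "u \<in> l2 m"
  shows "(\<lambda>(x, y). w x y * ((u x)\<^sup>2 + (u y)\<^sup>2)) summable_on UNIV"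
  using summable_on_add[OF fst_summable_and_le(1)[OF assms] snd_summable[OF assms]]
  by (simp add: case_prod_unfold distrib_left)

lemma diff_summable:
  assumes "u \<in> l2 m"
  shows "(\<lambda>(x, y). w x y * (u x - u y)\<^sup>2) summable_on UNIV"
proof (rule summable_on_abs_comparison[OF summable_on_cmult_right[OF ends_summable[OF assms]]])
  show "\<bar>case p of (x, y) \<Rightarrow> w x y * (u x - u y)\<^sup>2\<bar>
      \<le> 2 * (case p of (x, y) \<Rightarrow> w x y * ((u x)\<^sup>2 + (u y)\<^sup>2))" for p
  proof (cases p)
    case (Pair x y)
    have "(u x - u y)\<^sup>2 \<le> 2 * ((u x)\<^sup>2 + (u y)\<^sup>2)"
      using zero_le_power2[of "u x + u y"] by (simp add: power2_sum power2_diff)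
    from mult_left_mono[OF this nonneg[of x y]] show ?thesis
      by (simp add: Pair nonneg algebra_simps)
  qed
qed

lemma sum_summable:
  assumes "u \<in> l2 m"
  shows "(\<lambda>(x, y). w x y * (u x + u y)\<^sup>2) summable_on UNIV"
proof (rule summable_on_abs_comparison[OF summable_on_cmult_right[OF ends_summable[OF assms]]])
  show "\<bar>case p of (x, y) \<Rightarrow> w x y * (u x + u y)\<^sup>2\<bar>
      \<le> 2 * (case p of (x, y) \<Rightarrow> w x y * ((u x)\<^sup>2 + (u y)\<^sup>2))" for p
  proof (cases p)
    case (Pair x y)
    have "(u x + u y)\<^sup>2 \<le> 2 * ((u x)\<^sup>2 + (u y)\<^sup>2)"
      using zero_le_power2[of "u x - u y"] by (simp add: power2_sum power2_diff)
    from mult_left_mono[OF this nonneg[of x y]] show ?thesis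
      by (simp add: Pair nonneg algebra_simps)
  qed
qed

lemma form_Q_self: "form_Q w u u = (1/2) * (\<Sum>\<^sub>\<infinity>(x, y). w x y * (u x - u y)\<^sup>2)"
  by (simp add: form_Q_def power2_eq_square)

lemma form_Q_nonneg: "0 \<le> form_Q w u u"
  unfolding form_Q_self by (auto intro!: infsum_nonneg simp: nonneg)

text \<open>
  The parallelogram law \<open>(s + t)\<^sup>2 + (s - t)\<^sup>2 = 2 s\<^sup>2 + 2 t\<^sup>2\<close>, summed over all edges.  Keeping the negative term
  \<open>- Q(u)\<close> instead of bounding by \<open>4 \<parallel>u\<parallel>\<^sup>2\<close> is what sharpens \<open>\<alpha>\<^sup>2/2\<close> to \<open>1 - sqrt(1 - \<alpha>\<^sup>2)\<close> in the end.
\<close>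

lemma infsum_sum_le:
  assumes "u \<in> l2 m"
  shows "(\<Sum>\<^sub>\<infinity>(x, y). w x y * (u x + u y)\<^sup>2) \<le> 2 * (2 * l2_inner m u u - form_Q w u u)"
proof -
  have "(\<Sum>\<^sub>\<infinity>(x, y). w x y * (u x + u y)\<^sup>2) + (\<Sum>\<^sub>\<infinity>(x, y). w x y * (u x - u y)\<^sup>2)
      = (\<Sum>\<^sub>\<infinity>(x, y). w x y * (u x + u y)\<^sup>2 + w x y * (u x - u y)\<^sup>2)"
    using infsum_add[OF sum_summable[OF assms] diff_summable[OF assms]]
    by (simp add: case_prod_unfold)
  also have "\<dots> = (\<Sum>\<^sub>\<infinity>(x, y). 2 * (w x y * (u x)\<^sup>2) + 2 * (w x y * (u y)\<^sup>2))"
    by (simp add: power2_sum power2_diff algebra_simps)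
  also have "\<dots> = 2 * (\<Sum>\<^sub>\<infinity>(x, y). w x y * (u x)\<^sup>2) + 2 * (\<Sum>\<^sub>\<infinity>(x, y). w x y * (u y)\<^sup>2)"
    using infsum_add[OF summable_on_cmult_right[OF fst_summable_and_le(1)[OF assms], of 2]
        summable_on_cmult_right[OF snd_summable[OF assms], of 2]]
    by (simp add: case_prod_unfold infsum_cmult_right')
  also have "\<dots> \<le> 4 * l2_inner m u u"
    using fst_summable_and_le(2)[OF assms] by (simp add: infsum_snd)
  finally show ?thesis
    by (simp add: form_Q_self)
qed

lemma form_Q_le:
  assumes "u \<in> l2 m"
  shows "form_Q w u u \<le> 2 * l2_inner m u u"
proof -
  have "0 \<le> (\<Sum>\<^sub>\<infinity>(x, y). w x y * (u x + u y)\<^sup>2)"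
    by (auto intro!: infsum_nonneg simp: nonneg)
  then show ?thesis
    using infsum_sum_le[OF assms] by simp
qed

lemma diff_times_fst_summable:
  assumes "u \<in> l2 m" and "v \<in> l2 m"
  shows "(\<lambda>(x, y). w x y * (u x - u y) * v x) summable_on UNIV"
proof -
  have "(\<lambda>(x, y). (sqrt (w x y) * (u x - u y)) * (sqrt (w x y) * v x)) summable_on UNIV"
    using square_summable_mult[of "\<lambda>(x, y). sqrt (w x y) * (u x - u y)" UNIV
        "\<lambda>(x, y). sqrt (w x y) * v x"] diff_summable[OF assms(1)] fst_summable_and_le(1)[OF assms(2)]
    by (simp add: case_prod_unfold power_mult_distrib nonneg)
  moreover have "(sqrt (w x y) * (u x - u y)) * (sqrt (w x y) * v x) = w x y * (u x - u y) * v x"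
    for x y
    using real_sqrt_mult_self[of "w x y"] nonneg[of x y] by (simp add: algebra_simps)
  ultimately show ?thesis
    by simp
qed

end


section \<open>The Laplacian as a bounded operator\<close>

definition formal_laplacian :: "('a \<Rightarrow> 'a \<Rightarrow> real) \<Rightarrow> ('a \<Rightarrow> real) \<Rightarrow> ('a \<Rightarrow> real) \<Rightarrow> 'a \<Rightarrow> real" where
  "formal_laplacian w m u x = (\<Sum>\<^sub>\<infinity>y. w x y * (u x - u y)) / m x"

definition embed :: "('a \<Rightarrow> real) \<Rightarrow> ('a \<Rightarrow> real) \<Rightarrow> 'a square_summable" where
  "embed m u = Square_summable (\<lambda>x. sqrt (m x) * u x)"

definition unembed :: "('a \<Rightarrow> real) \<Rightarrow> 'a square_summable \<Rightarrow> 'a \<Rightarrow> real" where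
  "unembed m v x = coeff v x / sqrt (m x)"

lemma finitely_supported_l2: "u \<in> finitely_supported \<Longrightarrow> u \<in> l2 m"
proof -
  assume "u \<in> finitely_supported"
  then have "(\<lambda>x. (u x)\<^sup>2 * m x) summable_on {x. u x \<noteq> 0}"
    by (simp add: finitely_supported_def)
  then show ?thesis
    unfolding l2_def mem_Collect_eq
    by (subst summable_on_cong_neutral[where T = "{x. u x \<noteq> 0}"]) auto
qed

context edge_weight
begin

lemma coeff_embed: "u \<in> l2 m \<Longrightarrow> coeff (embed m u) x = sqrt (m x) * u x"
  using mass_pos
  by (simp add: embed_def coeff_Square_summable l2_def power_mult_distrib mult.commute less_imp_le)

lemma unembed_l2: "unembed m v \<in> l2 m"
  using summable_coeff[of v] mass_pos
  by (simp add: l2_def unembed_def power_divide less_imp_le less_imp_neq[THEN not_sym])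

lemma embed_unembed: "embed m (unembed m v) = v"
  using mass_pos
  by (simp add: embed_def unembed_def coeff_inverse less_imp_neq[THEN not_sym])

lemma unembed_embed: "u \<in> l2 m \<Longrightarrow> unembed m (embed m u) = u"
  using mass_pos by (auto simp: unembed_def coeff_embed less_imp_neq[THEN not_sym])

lemma bij_betw_embed: "bij_betw (embed m) (l2 m) UNIV"
  by (rule bij_betw_byWitness[where f' = "unembed m"])
    (auto simp: embed_unembed unembed_embed unembed_l2)

lemma inner_embed:
  assumes "u \<in> l2 m" and "v \<in> l2 m"
  shows "inner (embed m u) (embed m v) = l2_inner m u v"
proof -
  have *: "sqrt (m x) * u x * (sqrt (m x) * v x) = u x * v x * m x" for x
    using real_sqrt_mult_self[of "m x"] mass_pos[of x] by (simp add: algebra_simps)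
  show ?thesis
    unfolding inner_coeff l2_inner_def by (simp add: coeff_embed assms *)
qed

lemma norm_embed: "u \<in> l2 m \<Longrightarrow> norm (embed m u) = l2_norm m u"
  by (simp add: norm_eq_sqrt_inner inner_embed l2_norm_def)

lemma l2_norm_square: "u \<in> l2 m \<Longrightarrow> (l2_norm m u)\<^sup>2 = l2_inner m u u"
  by (simp add: norm_embed[symmetric] power2_norm_eq_inner inner_embed)

lemma unembed_diff: "unembed m (v - v') = (\<lambda>x. unembed m v x - unembed m v' x)"
  by (rule ext) (simp add: unembed_def coeff_diff diff_divide_distrib)

lemma unembed_scaleR: "unembed m (c *\<^sub>R v) = (\<lambda>x. c * unembed m v x)"
  by (rule ext) (simp add: unembed_def coeff_scaleR)

lemma embed_lincomb:
  assumes "u \<in> l2 m" and "v \<in> l2 m"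
  shows "(\<lambda>x. u x - c * v x) \<in> l2 m"
    and "embed m (\<lambda>x. u x - c * v x) = embed m u - c *\<^sub>R embed m v"
proof -
  have *: "(\<lambda>x. u x - c * v x) = unembed m (embed m u - c *\<^sub>R embed m v)"
    by (simp add: unembed_diff unembed_scaleR unembed_embed assms)
  show "(\<lambda>x. u x - c * v x) \<in> l2 m"
    unfolding * by (rule unembed_l2)
  show "embed m (\<lambda>x. u x - c * v x) = embed m u - c *\<^sub>R embed m v"
    unfolding * by (rule embed_unembed)
qed

text \<open>
  \<open>Q(u) \<le> 2 \<parallel>u\<parallel>\<^sup>2\<close> makes the form norm equivalent to the \<open>\<ell>\<^sup>2\<close> norm, in which the finitely supported
  functions are dense.
\<close>

lemma form_domain_eq_l2: "form_domain w m = l2 m"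
proof (intro equalityI subsetI)
  fix u
  assume u: "u \<in> l2 m"
  have "\<exists>\<phi>\<in>finitely_supported. norm_Q w m (\<lambda>x. u x - \<phi> x) < \<epsilon>" if "0 < \<epsilon>" for \<epsilon>
  proof -
    obtain v where v: "finite {i. coeff v i \<noteq> 0}" "norm (embed m u - v) < \<epsilon> / 2"
      using finite_support_dense[of "\<epsilon> / 2" "embed m u"] \<open>0 < \<epsilon>\<close> by auto
    let ?r = "\<lambda>x. u x - unembed m v x"
    have r: "?r = unembed m (embed m u - v)"
      by (simp add: unembed_diff unembed_embed u)
    have "norm_Q w m ?r \<le> sqrt (3 * (l2_norm m ?r)\<^sup>2)"
      using form_Q_le[of ?r] unembed_l2[of "embed m u - v"]
      by (simp add: norm_Q_def l2_norm_square r)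
    also have "\<dots> = sqrt 3 * norm (embed m u - v)"
      unfolding r norm_embed[OF unembed_l2, symmetric] embed_unembed by (simp add: real_sqrt_mult)
    also have "\<dots> \<le> 2 * norm (embed m u - v)"
      by (intro mult_right_mono real_le_lsqrt) auto
    also have "\<dots> < \<epsilon>"
      using v(2) by simp
    finally have "norm_Q w m ?r < \<epsilon>" .
    moreover have "unembed m v \<in> finitely_supported"
      using v(1) by (auto simp: finitely_supported_def unembed_def elim!: rev_finite_subset)
    ultimately show ?thesis
      by blast
  qed
  then show "u \<in> form_domain w m"
    using u diff_summable[OF u] by (simp add: form_domain_def finite_energy_def)
qed (simp add: form_domain_def)

text \<open>
  Cauchy--Schwarz on the row of \<open>x\<close> gives \<open>L u(x)\<^sup>2 m(x) \<le> \<Sum>\<^sub>y w(x,y) (u(x) - u(y))\<^sup>2\<close>, because the degree is at most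
  \<open>m(x)\<close>.  Summation over \<open>x\<close> yields \<open>\<parallel>L u\<parallel>\<^sup>2 \<le> 2 Q(u)\<close>.
\<close>

lemma formal_laplacian_l2:
  assumes "u \<in> l2 m"
  shows "formal_laplacian w m u \<in> l2 m"
    and "(l2_norm m (formal_laplacian w m u))\<^sup>2 \<le> 4 * (l2_norm m u)\<^sup>2"
proof -
  let ?Lu = "formal_laplacian w m u"
  have le: "(?Lu x)\<^sup>2 * m x \<le> (\<Sum>\<^sub>\<infinity>y. w x y * (u x - u y)\<^sup>2)" for x
  proof -
    let ?E = "\<Sum>\<^sub>\<infinity>y. w x y * (u x - u y)\<^sup>2"
    have E: "0 \<le> ?E"
      by (simp add: infsum_nonneg nonneg)
    have "(\<Sum>\<^sub>\<infinity>y. sqrt (w x y) * (sqrt (w x y) * (u x - u y)))\<^sup>2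
        \<le> (\<Sum>\<^sub>\<infinity>y. (sqrt (w x y))\<^sup>2) * (\<Sum>\<^sub>\<infinity>y. (sqrt (w x y) * (u x - u y))\<^sup>2)"
      using summable_row[of x] summable_on_pair_row[OF diff_summable[OF assms], of x]
      by (intro infsum_Cauchy_Schwarz) (simp_all add: power_mult_distrib nonneg)
    then have "(\<Sum>\<^sub>\<infinity>y. w x y * (u x - u y))\<^sup>2 \<le> (\<Sum>\<^sub>\<infinity>y. w x y) * ?E"
      by (simp add: power_mult_distrib nonneg flip: mult.assoc)
    also have "\<dots> \<le> m x * ?E"
      using degree_le E by (rule mult_right_mono)
    finally show ?thesis
      using mass_pos[of x] by (simp add: formal_laplacian_def power2_eq_square field_simps)
  qed
  have rows: "(\<lambda>x. \<Sum>\<^sub>\<infinity>y. w x y * (u x - u y)\<^sup>2) summable_on UNIV"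
    by (rule summable_on_row_sums[OF diff_summable[OF assms]])
  have Lu: "(\<lambda>x. (?Lu x)\<^sup>2 * m x) summable_on UNIV"
    by (rule summable_on_comparison_test[OF rows]) (use le mass_pos in \<open>auto simp: less_imp_le\<close>)
  then show L: "?Lu \<in> l2 m"
    by (simp add: l2_def)
  have "(l2_norm m ?Lu)\<^sup>2 \<le> (\<Sum>\<^sub>\<infinity>x. \<Sum>\<^sub>\<infinity>y. w x y * (u x - u y)\<^sup>2)"
    using infsum_mono[OF Lu rows le] unfolding l2_norm_square[OF L] l2_inner_def
    by (simp add: power2_eq_square)
  also have "\<dots> = 2 * form_Q w u u"
    by (simp add: infsum_row_sums[OF diff_summable[OF assms]] form_Q_self)
  also have "\<dots> \<le> 4 * (l2_norm m u)\<^sup>2"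
    using form_Q_le[OF assms] by (simp add: l2_norm_square[OF assms])
  finally show "(l2_norm m ?Lu)\<^sup>2 \<le> 4 * (l2_norm m u)\<^sup>2" .
qed

text \<open>
  Splitting \<open>(u(x) - u(y)) (v(x) - v(y))\<close> into its \<open>v(x)\<close> and \<open>v(y)\<close> parts gives two absolutely convergent sums
  that are exchanged by \<open>(x, y) \<mapsto> (y, x)\<close>; each equals \<open>\<langle>L u, v\<rangle>\<close>.
\<close>

lemma Green_formula:
  assumes "u \<in> l2 m" and "v \<in> l2 m"
  shows "form_Q w u v = l2_inner m (formal_laplacian w m u) v"
proof -
  let ?f = "\<lambda>x y. w x y * (u x - u y) * v x"
  have f: "(\<lambda>(x, y). ?f x y) summable_on UNIV"
    by (rule diff_times_fst_summable[OF assms])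
  then have f': "(\<lambda>(x, y). ?f y x) summable_on UNIV"
    by (subst summable_on_swap_pair)
  have "w x y * ((u x - u y) * (v x - v y)) = ?f x y + ?f y x" for x y
    by (simp add: sym[of y x] algebra_simps)
  then have "form_Q w u v = (1/2) * (\<Sum>\<^sub>\<infinity>(x, y). ?f x y + ?f y x)"
    by (simp add: form_Q_def)
  also have "\<dots> = (1/2) * ((\<Sum>\<^sub>\<infinity>(x, y). ?f x y) + (\<Sum>\<^sub>\<infinity>(x, y). ?f y x))"
    using infsum_add[OF f f'] by (simp add: case_prod_unfold)
  also have "\<dots> = (\<Sum>\<^sub>\<infinity>(x, y). ?f x y)"
    by (simp add: infsum_swap_pair[of ?f])
  also have "\<dots> = (\<Sum>\<^sub>\<infinity>x. (\<Sum>\<^sub>\<infinity>y. w x y * (u x - u y)) * v x)"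
    by (simp add: infsum_cmult_left' flip: infsum_row_sums[OF f])
  also have "\<dots> = l2_inner m (formal_laplacian w m u) v"
    unfolding l2_inner_def formal_laplacian_def using mass_pos
    by (simp add: less_imp_neq[THEN not_sym])
  finally show ?thesis .
qed

lemma form_Q_commute: "form_Q w u v = form_Q w v u"
  by (simp add: form_Q_def mult.commute)

text \<open>Uniqueness of the representing function comes from testing with the indicator of a point.\<close>

lemma represents_form_iff:
  assumes "u \<in> l2 m"
  shows "represents_form w m u f \<longleftrightarrow> f = formal_laplacian w m u"
proof
  assume f: "represents_form w m u f"
  show "f = formal_laplacian w m u"
  proof
    fix x
    define \<delta> where "\<delta> y = (if y = x then 1 else 0 :: real)" for y :: 'a
    have \<delta>: "\<delta> \<in> l2 m"
      by (rule finitely_supported_l2) (simp add: finitely_supported_def \<delta>_def)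
    have inner_\<delta>: "l2_inner m g \<delta> = g x * m x" for g
    proof -
      have "l2_inner m g \<delta> = (\<Sum>\<^sub>\<infinity>y\<in>{x}. g y * m y)"
        unfolding l2_inner_def by (rule infsum_cong_neutral) (auto simp: \<delta>_def)
      then show ?thesis
        by simp
    qed
    have "l2_inner m f \<delta> = l2_inner m (formal_laplacian w m u) \<delta>"
      using f \<delta> Green_formula[OF assms \<delta>] by (simp add: represents_form_def form_domain_eq_l2)
    then show "f x = formal_laplacian w m u x"
      using mass_pos[of x] by (simp add: inner_\<delta>)
  qed
qed (simp add: represents_form_def form_domain_eq_l2 formal_laplacian_l2 Green_formula assms)

lemma laplacian_domain_eq_l2: "laplacian_domain w m = l2 m"
  by (auto simp: laplacian_domain_def form_domain_eq_l2 represents_form_iff)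

lemma laplacian_eq_formal: "u \<in> l2 m \<Longrightarrow> laplacian w m u = formal_laplacian w m u"
  by (simp add: laplacian_def represents_form_iff)

text \<open>The conjugate of the Laplacian under the isometry \<open>embed m\<close>.\<close>

definition operator :: "'a square_summable \<Rightarrow> 'a square_summable" where
  "operator v = embed m (formal_laplacian w m (unembed m v))"

lemma operator_embed: "u \<in> l2 m \<Longrightarrow> operator (embed m u) = embed m (laplacian w m u)"
  by (simp add: operator_def unembed_embed laplacian_eq_formal)

lemma inner_operator: "inner (operator v) v' = form_Q w (unembed m v) (unembed m v')"
  using inner_embed[OF formal_laplacian_l2(1)[OF unembed_l2] unembed_l2, of v v']
  by (simp add: operator_def embed_unembed Green_formula unembed_l2)

lemma operator_sym: "inner (operator v) v' = inner v (operator v')"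
  by (simp add: inner_operator form_Q_commute inner_commute[of v])

lemma bounded_linear_operator: "bounded_linear operator"
proof (rule bounded_linear_intro[where K = 2])
  fix v v' :: "'a square_summable" and c :: real
  \<comment> \<open>Linearity follows from symmetry, since \<open>v\<close> occurs linearly in \<open>\<langle>v, T z\<rangle>\<close>.\<close>
  have "inner (operator (v + v') - (operator v + operator v')) z = 0" for z
    by (simp add: inner_diff_left inner_add_left operator_sym)
  then show "operator (v + v') = operator v + operator v'"
    by (metis eq_iff_diff_eq_0 inner_eq_zero_iff)
  have "inner (operator (c *\<^sub>R v) - c *\<^sub>R operator v) z = 0" for z
    by (simp add: inner_diff_left operator_sym)
  then show "operator (c *\<^sub>R v) = c *\<^sub>R operator v"
    by (metis eq_iff_diff_eq_0 inner_eq_zero_iff)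
  have "(norm (operator v))\<^sup>2 \<le> (norm v * 2)\<^sup>2"
    using formal_laplacian_l2[OF unembed_l2, of v] norm_embed[OF unembed_l2, of v]
    by (simp add: operator_def norm_embed embed_unembed power_mult_distrib)
  then show "norm (operator v) \<le> norm v * 2"
    by (rule power2_le_imp_le) simp
qed

lemma norm_shifted_operator_embed:
  assumes "u \<in> l2 m"
  shows "(\<lambda>x. laplacian w m u x - s * u x) \<in> l2 m"
    and "embed m (\<lambda>x. laplacian w m u x - s * u x) = operator (embed m u) - s *\<^sub>R embed m u"
    and "l2_norm m (\<lambda>x. laplacian w m u x - s * u x) = norm (operator (embed m u) - s *\<^sub>R embed m u)"
proof -
  have L: "laplacian w m u \<in> l2 m"
    using assms by (simp add: laplacian_eq_formal formal_laplacian_l2)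
  show *: "(\<lambda>x. laplacian w m u x - s * u x) \<in> l2 m"
    "embed m (\<lambda>x. laplacian w m u x - s * u x) = operator (embed m u) - s *\<^sub>R embed m u"
    using embed_lincomb[OF L assms] assms by (simp_all add: operator_embed)
  show "l2_norm m (\<lambda>x. laplacian w m u x - s * u x) = norm (operator (embed m u) - s *\<^sub>R embed m u)"
    using norm_embed[OF *(1)] *(2) by simp
qed

lemma in_spectrum_iff:
  "s \<in> spectrum m (laplacian_domain w m) (laplacian w m) \<longleftrightarrow>
     \<not> (bij (\<lambda>v. operator v - s *\<^sub>R v) \<and> (\<exists>C. \<forall>v. norm v \<le> C * norm (operator v - s *\<^sub>R v)))"
proof -
  let ?R = "\<lambda>v. operator v - s *\<^sub>R v" and ?S = "\<lambda>u x. laplacian w m u x - s * u x"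
  have "bij_betw ?S (l2 m) (l2 m) \<longleftrightarrow> bij_betw (embed m \<circ> ?S) (l2 m) UNIV"
    using norm_shifted_operator_embed(1)
    by (intro bij_betw_comp_iff2[OF bij_betw_embed]) auto
  also have "\<dots> \<longleftrightarrow> bij_betw (?R \<circ> embed m) (l2 m) UNIV"
    by (rule bij_betw_cong) (simp add: norm_shifted_operator_embed)
  also have "\<dots> \<longleftrightarrow> bij ?R"
    by (rule bij_betw_comp_iff[OF bij_betw_embed, symmetric])
  finally have bij: "bij_betw ?S (l2 m) (l2 m) \<longleftrightarrow> bij ?R" .
  have "(\<forall>u\<in>l2 m. l2_norm m u \<le> C * l2_norm m (?S u)) \<longleftrightarrow> (\<forall>v. norm v \<le> C * norm (?R v))" for C
  proof (intro iffI ballI allI)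
    fix v
    assume "\<forall>u\<in>l2 m. l2_norm m u \<le> C * l2_norm m (?S u)"
    then have "l2_norm m (unembed m v) \<le> C * l2_norm m (?S (unembed m v))"
      using unembed_l2 by blast
    then show "norm v \<le> C * norm (?R v)"
      by (simp add: norm_shifted_operator_embed(3) unembed_l2 embed_unembed flip: norm_embed)
  next
    fix u
    assume "\<forall>v. norm v \<le> C * norm (?R v)" and "u \<in> l2 m"
    then show "l2_norm m u \<le> C * l2_norm m (?S u)"
      by (simp add: norm_shifted_operator_embed(3) flip: norm_embed)
  qed
  with bij show ?thesis
    by (simp add: spectrum_def resolvent_set_def laplacian_domain_eq_l2)
qed

lemma spectrum_nonempty: "spectrum m (laplacian_domain w m) (laplacian w m) \<noteq> {}"
proof -
  \<comment> \<open>The indicator of \<open>undefined\<close>, an arbitrary vertex, shows that the Hilbert space is not zero.\<close>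
  have "coeff (Square_summable (\<lambda>x. if x = undefined then 1 else 0)) undefined = 1"
    by (subst coeff_Square_summable)
      (auto intro!: finite_nonzero_values_imp_summable_on)
  then have "Square_summable (\<lambda>x :: 'a. if x = undefined then 1 else 0) \<noteq> 0"
    by (metis zero_neq_one zero_square_summable.rep_eq)
  from not_bounded_below_at_Rayleigh_Inf[OF bounded_linear_operator operator_sym this]
  obtain r where "\<nexists>C. \<forall>v. norm v \<le> C * norm (operator v - r *\<^sub>R v)"
    by blast
  then have "r \<in> spectrum m (laplacian_domain w m) (laplacian w m)"
    by (simp add: in_spectrum_iff)
  then show ?thesis
    by blast
qed

text \<open>
  Both sides of the hypothesis are continuous in \<open>u\<close>, so it extends from finitely supported functions to the
  whole space and makes \<open>L - s\<close> coercive for every \<open>s < r\<close>.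
\<close>

theorem spectral_bottom_ge:
  assumes "\<And>u. u \<in> finitely_supported \<Longrightarrow> r * l2_inner m u u \<le> form_Q w u u"
  shows "r \<le> spectral_bottom w m"
proof -
  have coercive: "r * (norm v)\<^sup>2 \<le> inner (operator v) v" for v
  proof -
    let ?A = "{v. r * (norm v)\<^sup>2 \<le> inner (operator v) v}"
    have "closed ?A"
      by (intro closed_Collect_le continuous_intros linear_continuous_on[OF bounded_linear_operator])
    moreover have "v \<in> closure ?A"
      unfolding closure_approachable
    proof (intro allI impI)
      fix e :: real
      assume "0 < e"
      then obtain y where y: "finite {i. coeff y i \<noteq> 0}" "norm (v - y) < e"
        by (rule finite_support_dense)
      have "unembed m y \<in> finitely_supported"
        using y(1) by (auto simp: finitely_supported_def unembed_def elim!: rev_finite_subset)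
      from assms[OF this] have "y \<in> ?A"
        using inner_embed[OF unembed_l2 unembed_l2, of y y]
        by (simp add: inner_operator embed_unembed power2_norm_eq_inner)
      then show "\<exists>y\<in>?A. dist y v < e"
        using y(2) by (auto simp: dist_norm norm_minus_commute)
    qed
    ultimately show ?thesis
      by (simp add: closure_closed)
  qed
  have "r \<le> s" if s: "s \<in> spectrum m (laplacian_domain w m) (laplacian w m)" for s
  proof (rule ccontr)
    assume "\<not> r \<le> s"
    then have "0 < r - s"
      by simp
    let ?R = "\<lambda>v. operator v - s *\<^sub>R v"
    have lin: "bounded_linear ?R"
      by (intro bounded_linear_sub bounded_linear_operator bounded_linear_scaleR_right)
    have coer: "(r - s) * (norm v)\<^sup>2 \<le> inner (?R v) v" for v
      using coercive[of v] by (simp add: inner_diff_left power2_norm_eq_inner left_diff_distrib)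
    have "bij ?R"
      using lin \<open>0 < r - s\<close> coer by (rule coercive_imp_bij)
    moreover have "norm v \<le> (1 / (r - s)) * norm (?R v)" for v
      using \<open>0 < r - s\<close> coer by (rule coercive_imp_bounded_below)
    ultimately show False
      using s unfolding in_spectrum_iff by blast
  qed
  then show ?thesis
    unfolding spectral_bottom_def by (rule cInf_greatest[OF spectrum_nonempty])
qed

end

section \<open>The isoperimetric inequality for functions\<close>

context edge_weight
begin

lemma abs_diff_summable:
  assumes "g \<in> finitely_supported"
  shows "(\<lambda>(x, y). w x y * \<bar>g x - g y\<bar>) summable_on UNIV"
proof -
  \<comment> \<open>The estimates for \<open>u\<^sup>2\<close> apply to \<open>|g|\<close> with \<open>u = |g|\<^sup>1\<^sup>/\<^sup>2\<close>.\<close>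
  have "(\<lambda>x. sqrt \<bar>g x\<bar>) \<in> l2 m"
    using assms by (intro finitely_supported_l2) (simp add: finitely_supported_def)
  from ends_summable[OF this]
  have "(\<lambda>(x, y). w x y * (\<bar>g x\<bar> + \<bar>g y\<bar>)) summable_on UNIV"
    by simp
  then show ?thesis
  proof (rule summable_on_abs_comparison)
    show "\<bar>case p of (x, y) \<Rightarrow> w x y * \<bar>g x - g y\<bar>\<bar> \<le> (case p of (x, y) \<Rightarrow> w x y * (\<bar>g x\<bar> + \<bar>g y\<bar>))"
      for p
      by (cases p) (auto simp: abs_mult nonneg intro!: mult_left_mono)
  qed
qed

text \<open>Every boundary edge of \<open>W\<close> is counted once in each orientation.\<close>

lemma infsum_abs_diff_indicator:
  assumes "finite W"
  shows "(\<Sum>\<^sub>\<infinity>(x, y). w x y * \<bar>indicator W x - indicator W y\<bar>) = 2 * (\<Sum>\<^sub>\<infinity>(x, y)\<in>W \<times> - W. w x y)"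
proof -
  define h where "h x y = w x y * of_bool (x \<in> W \<and> y \<notin> W)" for x y
  have "(indicator W :: 'a \<Rightarrow> real) \<in> finitely_supported"
    using assms by (simp add: finitely_supported_def indicator_def)
  from abs_diff_summable[OF this] have h: "(\<lambda>(x, y). h x y) summable_on UNIV"
  proof (rule summable_on_abs_comparison)
    show "\<bar>case p of (x, y) \<Rightarrow> h x y\<bar>
        \<le> (case p of (x, y) \<Rightarrow> w x y * \<bar>indicator W x - indicator W y\<bar>)" for p
      by (cases p) (simp add: h_def nonneg)
  qed
  then have h': "(\<lambda>(x, y). h y x) summable_on UNIV"
    by (subst summable_on_swap_pair)
  have "w x y * \<bar>indicator W x - indicator W y\<bar> = h x y + h y x" for x y
    by (simp add: h_def sym[of y x] indicator_def)
  then have "(\<Sum>\<^sub>\<infinity>(x, y). w x y * \<bar>indicator W x - indicator W y\<bar>)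
      = (\<Sum>\<^sub>\<infinity>(x, y). h x y) + (\<Sum>\<^sub>\<infinity>(x, y). h y x)"
    using infsum_add[OF h h'] by (simp add: case_prod_unfold)
  also have "\<dots> = 2 * (\<Sum>\<^sub>\<infinity>(x, y). h x y)"
    by (simp add: infsum_swap_pair[of h])
  also have "(\<Sum>\<^sub>\<infinity>(x, y). h x y) = (\<Sum>\<^sub>\<infinity>(x, y)\<in>W \<times> - W. w x y)"
    by (rule infsum_cong_neutral) (auto simp: h_def)
  finally show ?thesis .
qed

text \<open>
  This is the coarea formula \<open>\<Sum> w |g(x) - g(y)| = 2 \<integral> |\<partial>{g > t}| dt\<close> combined with the isoperimetric inequality for
  the superlevel sets.  As \<open>g\<close> takes finitely many values, the integral is replaced by an induction that
  peels off the lowest layer: if \<open>c\<close> is the least value of \<open>g\<close> on its support \<open>W\<close>, then \<open>g = c 1\<^sub>W + g'\<close>, where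
  \<open>g' \<ge> 0\<close> has smaller support.
\<close>

lemma isoperimetric_inequality:
  assumes iso: "\<And>W. finite W \<Longrightarrow> W \<noteq> {} \<Longrightarrow> a * sum m W \<le> (\<Sum>\<^sub>\<infinity>(x, y)\<in>W \<times> - W. w x y)"
    and "g \<in> finitely_supported" and "\<And>x. 0 \<le> g x"
  shows "2 * a * (\<Sum>\<^sub>\<infinity>x. g x * m x) \<le> (\<Sum>\<^sub>\<infinity>(x, y). w x y * \<bar>g x - g y\<bar>)"
  using assms(2,3)
proof (induction "card {x. g x \<noteq> 0}" arbitrary: g rule: less_induct)
  case less
  define W where "W = {x. g x \<noteq> 0}"
  have "finite W"
    using less.prems(1) by (simp add: W_def finitely_supported_def)
  show ?case
  proof (cases "W = {}")
    case True
    then have "g = (\<lambda>_. 0)"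
      by (auto simp: W_def)
    then show ?thesis
      by (simp add: case_prod_unfold)
  next
    case False
    define c where "c = Min (g ` W)"
    define g' where "g' x = g x - c * indicator W x" for x
    obtain z where z: "z \<in> W" "g z = c"
      using Min_in[of "g ` W"] \<open>finite W\<close> False unfolding c_def by fastforce
    have c_le: "c \<le> g x" if "x \<in> W" for x
      using \<open>finite W\<close> that by (simp add: c_def)
    have "0 \<le> c"
      using less.prems(2)[of z] z by simp
    have g': "0 \<le> g' x" for x
      using c_le[of x] less.prems(2)[of x] by (simp add: g'_def indicator_def)
    have sub: "{x. g' x \<noteq> 0} \<subseteq> W - {z}"
      using z by (auto simp: g'_def W_def indicator_def)
    then have fs: "g' \<in> finitely_supported"
      using \<open>finite W\<close> by (auto simp: finitely_supported_def intro: finite_subset)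
    have "card {x. g' x \<noteq> 0} < card W"
      using sub z \<open>finite W\<close> by (intro psubset_card_mono) auto
    then have IH: "2 * a * (\<Sum>\<^sub>\<infinity>x. g' x * m x) \<le> (\<Sum>\<^sub>\<infinity>(x, y). w x y * \<bar>g' x - g' y\<bar>)"
      using less.hyps fs g' by (simp add: W_def)
    have mass: "(\<Sum>\<^sub>\<infinity>x. f x * m x) = (\<Sum>x\<in>W. f x * m x)" if "{x. f x \<noteq> 0} \<subseteq> W" for f
    proof -
      have "(\<Sum>\<^sub>\<infinity>x. f x * m x) = (\<Sum>\<^sub>\<infinity>x\<in>W. f x * m x)"
        using that by (intro infsum_cong_neutral) auto
      then show ?thesis
        using \<open>finite W\<close> by simp
    qed
    have "(\<Sum>\<^sub>\<infinity>x. g x * m x) = (\<Sum>x\<in>W. (c + g' x) * m x)"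
      by (simp add: mass W_def[symmetric] g'_def)
    also have "\<dots> = c * sum m W + (\<Sum>\<^sub>\<infinity>x. g' x * m x)"
      using sub by (subst mass) (auto simp: distrib_right sum.distrib sum_distrib_left)
    finally have "2 * a * (\<Sum>\<^sub>\<infinity>x. g x * m x) = 2 * (c * (a * sum m W)) + 2 * a * (\<Sum>\<^sub>\<infinity>x. g' x * m x)"
      by (simp add: algebra_simps)
    also have "\<dots> \<le> 2 * (c * (\<Sum>\<^sub>\<infinity>(x, y)\<in>W \<times> - W. w x y)) + (\<Sum>\<^sub>\<infinity>(x, y). w x y * \<bar>g' x - g' y\<bar>)"
      using iso[OF \<open>finite W\<close> False] \<open>0 \<le> c\<close> IH by (intro add_mono mult_left_mono) auto
    also have "\<dots> = (\<Sum>\<^sub>\<infinity>(x, y). c * (w x y * \<bar>indicator W x - indicator W y\<bar>))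
        + (\<Sum>\<^sub>\<infinity>(x, y). w x y * \<bar>g' x - g' y\<bar>)"
      using infsum_abs_diff_indicator[OF \<open>finite W\<close>]
      by (simp add: case_prod_unfold infsum_cmult_right')
    also have "\<dots> = (\<Sum>\<^sub>\<infinity>(x, y). c * (w x y * \<bar>indicator W x - indicator W y\<bar>) + w x y * \<bar>g' x - g' y\<bar>)"
    proof -
      have "(indicator W :: 'a \<Rightarrow> real) \<in> finitely_supported"
        using \<open>finite W\<close> by (simp add: finitely_supported_def indicator_def)
      from infsum_add[OF summable_on_cmult_right[OF abs_diff_summable[OF this], of c]
          abs_diff_summable[OF fs]]
      show ?thesis
        by (simp add: case_prod_unfold)
    qed
    \<comment> \<open>\<open>c 1\<^sub>W\<close> and \<open>g'\<close> vary in the same direction along each edge, because \<open>g'\<close> vanishes off \<open>W\<close>.\<close>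
    also have "\<dots> = (\<Sum>\<^sub>\<infinity>(x, y). w x y * \<bar>g x - g y\<bar>)"
    proof -
      have "c * \<bar>indicator W x - indicator W y\<bar> + \<bar>g' x - g' y\<bar> = \<bar>g x - g y\<bar>" for x y
        using c_le[of x] c_le[of y] \<open>0 \<le> c\<close> by (auto simp: g'_def indicator_def W_def)
      then have "c * (w x y * \<bar>indicator W x - indicator W y\<bar>) + w x y * \<bar>g' x - g' y\<bar>
          = w x y * \<bar>g x - g y\<bar>" for x y
        by (metis distrib_left mult.left_commute)
      then show ?thesis
        by simp
    qed
    finally show ?thesis .
  qed
qed

end

lemma boundary_area_nonneg:
  assumes "\<And>x y. 0 \<le> b x y" and "\<And>x y. 0 \<le> d x y"
  shows "0 \<le> boundary_area b d W"
  unfolding boundary_area_def by (rule infsum_nonneg) (auto simp: assms)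

lemma isoperimetric_constant_nonneg:
  assumes "\<And>x. 0 < m x" and "\<And>x y. 0 \<le> b x y" and "\<And>x y. 0 \<le> d x y"
    and "U \<noteq> {}"
  shows "0 \<le> isoperimetric_constant b m d U"
  unfolding isoperimetric_constant_def
proof (rule cINF_greatest)
  obtain x where "x \<in> U"
    using \<open>U \<noteq> {}\<close> by blast
  then have "{x} \<in> {W. W \<subseteq> U \<and> finite W \<and> W \<noteq> {}}"
    by simp
  then show "{W. W \<subseteq> U \<and> finite W \<and> W \<noteq> {}} \<noteq> {}"
    by blast
  show "0 \<le> boundary_area b d W / sum m W" for W
    by (intro divide_nonneg_nonneg boundary_area_nonneg sum_nonneg less_imp_le assms)
qed

lemma isoperimetric_constant_le:
  assumes "\<And>x. 0 < m x" and "\<And>x y. 0 \<le> b x y" and "\<And>x y. 0 \<le> d x y"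
    and "W \<subseteq> U" and "finite W" and "W \<noteq> {}"
  shows "isoperimetric_constant b m d U * sum m W \<le> boundary_area b d W"
proof -
  have "0 \<le> boundary_area b d V / sum m V" for V
    by (intro divide_nonneg_nonneg boundary_area_nonneg sum_nonneg less_imp_le assms)
  then have "isoperimetric_constant b m d U \<le> boundary_area b d W / sum m W"
    unfolding isoperimetric_constant_def
    by (intro cINF_lower bdd_belowI2[of _ 0]) (use assms(4-6) in auto)
  moreover have "0 < sum m W"
    using assms by (intro sum_pos) auto
  ultimately show ?thesis
    by (simp add: field_simps)
qed

lemma boundary_area_eq:
  assumes "\<And>x y. 0 \<le> b x y"
  shows "boundary_area b d W = (\<Sum>\<^sub>\<infinity>(x, y)\<in>W \<times> - W. b x y * d x y)"
  unfolding boundary_area_def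
  by (rule infsum_cong_neutral) (use assms in \<open>auto simp: edge_boundary_def less_le\<close>)


section \<open>The Cheeger inequality\<close>

text \<open>
  The common setting of the two cases of the theorem: an edge length \<open>\<rho>\<close> that dominates both \<open>d\<close> and \<open>1\<close> and is
  still intrinsic.
\<close>

locale edge_lengths = edge_weight b m + lengths: edge_weight "\<lambda>x y. b x y * (\<rho> x y)\<^sup>2" m
  for b \<rho> :: "'a \<Rightarrow> 'a \<Rightarrow> real" and m +
  fixes d :: "'a \<Rightarrow> 'a \<Rightarrow> real"
  assumes d_nonneg: "0 \<le> d x y" and d_sym: "d x y = d y x"
    and d_le: "0 < b x y \<Longrightarrow> d x y \<le> \<rho> x y" and length_ge_1: "0 < b x y \<Longrightarrow> 1 \<le> \<rho> x y"
begin

lemma weighted_le: "b x y \<le> b x y * (\<rho> x y)\<^sup>2" "b x y * d x y \<le> b x y * (\<rho> x y)\<^sup>2"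
proof -
  have "b x y * 1 \<le> b x y * (\<rho> x y)\<^sup>2 \<and> b x y * d x y \<le> b x y * (\<rho> x y)\<^sup>2"
  proof (cases "b x y = 0")
    case False
    then have "0 < b x y"
      using nonneg[of x y] by simp
    then have "1 \<le> \<rho> x y" "d x y \<le> \<rho> x y"
      by (simp_all add: d_le length_ge_1)
    moreover from this have "\<rho> x y \<le> (\<rho> x y)\<^sup>2"
      by (simp add: self_le_power)
    ultimately show ?thesis
      using \<open>0 < b x y\<close> by (intro conjI mult_left_mono) auto
  qed simp
  then show "b x y \<le> b x y * (\<rho> x y)\<^sup>2" "b x y * d x y \<le> b x y * (\<rho> x y)\<^sup>2"
    by simp_all
qed

sublocale area: edge_weight "\<lambda>x y. b x y * d x y" m
proof
  fix x y
  show "0 \<le> b x y * d x y" "b x y * d x y = b y x * d y x" "0 < m x"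
    by (simp_all add: nonneg d_nonneg sym[of x y] d_sym[of x y] mass_pos)
  show row: "(\<lambda>y. b x y * d x y) summable_on UNIV"
    using lengths.summable_row[of x]
    by (rule summable_on_comparison_test) (simp_all add: weighted_le nonneg d_nonneg)
  have "(\<Sum>\<^sub>\<infinity>y. b x y * d x y) \<le> (\<Sum>\<^sub>\<infinity>y. b x y * (\<rho> x y)\<^sup>2)"
    by (rule infsum_mono[OF row lengths.summable_row weighted_le(2)])
  also have "\<dots> \<le> m x"
    by (rule lengths.degree_le)
  finally show "(\<Sum>\<^sub>\<infinity>y. b x y * d x y) \<le> m x" .
qed

lemma form_Q_le_weighted:
  assumes "u \<in> l2 m"
  shows "form_Q b u u \<le> form_Q (\<lambda>x y. b x y * (\<rho> x y)\<^sup>2) u u"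
proof -
  have "(\<Sum>\<^sub>\<infinity>(x, y). b x y * (u x - u y)\<^sup>2) \<le> (\<Sum>\<^sub>\<infinity>(x, y). b x y * (\<rho> x y)\<^sup>2 * (u x - u y)\<^sup>2)"
    by (rule infsum_mono[OF diff_summable[OF assms] lengths.diff_summable[OF assms]])
      (auto intro!: mult_right_mono weighted_le)
  then show ?thesis
    by (simp add: form_Q_self lengths.form_Q_self)
qed

text \<open>
  Here \<open>|u(x)\<^sup>2 - u(y)\<^sup>2| = |u(x) - u(y)| |u(x) + u(y)|\<close>, and the length \<open>\<rho>\<close> is put entirely on the second factor,
  so that the first one is the energy.
\<close>

lemma Cheeger_quadratic:
  assumes "u \<in> finitely_supported"
  shows "(isoperimetric_constant b m d UNIV * l2_inner m u u)\<^sup>2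
    \<le> form_Q b u u * (2 * l2_inner m u u - form_Q b u u)"
proof -
  let ?\<alpha> = "isoperimetric_constant b m d UNIV" and ?N = "l2_inner m u u"
  let ?f = "\<lambda>(x, y). sqrt (b x y) * \<bar>u x - u y\<bar>"
  let ?g = "\<lambda>(x, y). sqrt (b x y) * \<rho> x y * \<bar>u x + u y\<bar>"
  have u: "u \<in> l2 m"
    by (rule finitely_supported_l2[OF assms])
  have "0 \<le> ?N"
    by (simp add: l2_norm_square[OF u, symmetric])
  have iso: "?\<alpha> * sum m W \<le> (\<Sum>\<^sub>\<infinity>(x, y)\<in>W \<times> - W. b x y * d x y)" if "finite W" "W \<noteq> {}" for W
    using isoperimetric_constant_le[of m b d W UNIV] that
    by (simp add: mass_pos nonneg d_nonneg boundary_area_eq)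
  have u2: "(\<lambda>x. (u x)\<^sup>2) \<in> finitely_supported"
    using assms by (simp add: finitely_supported_def)
  have f2: "(?f p)\<^sup>2 = (case p of (x, y) \<Rightarrow> b x y * (u x - u y)\<^sup>2)" for p
    by (cases p) (simp add: power_mult_distrib nonneg)
  have g2: "(?g p)\<^sup>2 = (case p of (x, y) \<Rightarrow> b x y * (\<rho> x y)\<^sup>2 * (u x + u y)\<^sup>2)" for p
    by (cases p) (simp add: power_mult_distrib nonneg)
  have sf: "(\<lambda>p. (?f p)\<^sup>2) summable_on UNIV"
    unfolding f2 by (rule diff_summable[OF u])
  have sg: "(\<lambda>p. (?g p)\<^sup>2) summable_on UNIV"
    unfolding g2 by (rule lengths.sum_summable[OF u])
  have fg: "(case p of (x, y) \<Rightarrow> b x y * d x y * \<bar>(u x)\<^sup>2 - (u y)\<^sup>2\<bar>) \<le> ?f p * ?g p" for p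
  proof (cases p)
    case (Pair x y)
    have "b x y * d x y \<le> b x y * \<rho> x y"
      using d_le[of x y] nonneg[of x y] by (cases "b x y = 0") auto
    then have "b x y * d x y * \<bar>(u x)\<^sup>2 - (u y)\<^sup>2\<bar> \<le> b x y * \<rho> x y * \<bar>(u x)\<^sup>2 - (u y)\<^sup>2\<bar>"
      by (rule mult_right_mono) simp
    also have "\<dots> = b x y * (\<rho> x y * (\<bar>u x - u y\<bar> * \<bar>u x + u y\<bar>))"
      by (simp add: power2_eq_square square_diff_square_factored abs_mult mult.commute)
    also have "\<dots> = (sqrt (b x y) * sqrt (b x y)) * (\<rho> x y * (\<bar>u x - u y\<bar> * \<bar>u x + u y\<bar>))"
      by (simp add: nonneg)
    also have "\<dots> = ?f p * ?g p"
      unfolding Pair prod.case by (simp only: ac_simps)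
    finally show ?thesis
      by (simp add: Pair)
  qed
  have area: "2 * ?\<alpha> * ?N \<le> (\<Sum>\<^sub>\<infinity>p. ?f p * ?g p)"
  proof -
    have "2 * ?\<alpha> * ?N \<le> (\<Sum>\<^sub>\<infinity>(x, y). b x y * d x y * \<bar>(u x)\<^sup>2 - (u y)\<^sup>2\<bar>)"
      using area.isoperimetric_inequality[OF iso u2] by (simp add: l2_inner_def power2_eq_square)
    also have "\<dots> \<le> (\<Sum>\<^sub>\<infinity>p. ?f p * ?g p)"
      by (rule infsum_mono[OF area.abs_diff_summable[OF u2] square_summable_mult[OF sf sg] fg])
    finally show ?thesis .
  qed
  have "0 \<le> ?\<alpha>"
    using isoperimetric_constant_nonneg[of m b d UNIV] by (simp add: mass_pos nonneg d_nonneg)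
  then have "(2 * ?\<alpha> * ?N)\<^sup>2 \<le> (\<Sum>\<^sub>\<infinity>p. ?f p * ?g p)\<^sup>2"
    using area \<open>0 \<le> ?N\<close> by (intro power_mono) auto
  also have "\<dots> \<le> (\<Sum>\<^sub>\<infinity>p. (?f p)\<^sup>2) * (\<Sum>\<^sub>\<infinity>p. (?g p)\<^sup>2)"
    by (rule infsum_Cauchy_Schwarz[OF sf sg])
  also have "\<dots> = 2 * form_Q b u u * (\<Sum>\<^sub>\<infinity>p. (?g p)\<^sup>2)"
    unfolding f2 by (simp add: form_Q_self)
  also have "\<dots> \<le> 2 * form_Q b u u * (2 * (2 * ?N - form_Q b u u))"
  proof (rule mult_left_mono)
    show "(\<Sum>\<^sub>\<infinity>p. (?g p)\<^sup>2) \<le> 2 * (2 * ?N - form_Q b u u)"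
      unfolding g2 using lengths.infsum_sum_le[OF u] form_Q_le_weighted[OF u] by simp
  qed (simp add: form_Q_nonneg)
  finally show ?thesis
    by (simp add: power2_eq_square algebra_simps)
qed

text \<open>
  The quadratic inequality reads \<open>(N - Q)\<^sup>2 \<le> (1 - \<alpha>\<^sup>2) N\<^sup>2\<close> after completing the square.  For \<open>u \<noteq> 0\<close> this forces
  \<open>\<alpha> \<le> 1\<close>.
\<close>

lemma Cheeger_inequality:
  assumes "u \<in> finitely_supported"
  shows "(1 - sqrt (1 - (isoperimetric_constant b m d UNIV)\<^sup>2)) * l2_inner m u u \<le> form_Q b u u"
proof -
  let ?\<alpha> = "isoperimetric_constant b m d UNIV" and ?N = "l2_inner m u u"
  have "0 \<le> ?N"
    using finitely_supported_l2[OF assms] by (simp add: l2_norm_square[symmetric])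
  have "(?N - form_Q b u u)\<^sup>2 \<le> (1 - ?\<alpha>\<^sup>2) * ?N\<^sup>2"
    using Cheeger_quadratic[OF assms] by (simp add: power2_eq_square algebra_simps)
  then have "?N - form_Q b u u \<le> sqrt ((1 - ?\<alpha>\<^sup>2) * ?N\<^sup>2)"
    by (rule real_le_rsqrt)
  also have "\<dots> = sqrt (1 - ?\<alpha>\<^sup>2) * ?N"
    using \<open>0 \<le> ?N\<close> by (simp add: real_sqrt_mult)
  finally show ?thesis
    by (simp add: left_diff_distrib)
qed

end

section \<open>The bottom of the spectrum\<close>

theorem theorem3p2:
  fixes b d :: "'a \<Rightarrow> 'a \<Rightarrow> real" and m :: "'a \<Rightarrow> real"
  assumes "discrete_measure_space m"
    and "graph b"
    and "intrinsic_metric b m d"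
    and "\<forall>x. m x \<ge> weighted_degree b x"
    and "(\<forall>x y. b x y > 0 \<longrightarrow> d x y \<ge> 1) \<or> (\<forall>x y. b x y > 0 \<longrightarrow> d x y \<le> 1)"
  shows "spectral_bottom b m \<ge> 1 - sqrt (1 - (isoperimetric_constant b m d UNIV)\<^sup>2)"
proof -
  have m: "\<And>x. 0 < m x"
    using assms(1) by (simp add: discrete_measure_space_def)
  have b: "\<And>x y. 0 \<le> b x y" "\<And>x y. b x y = b y x" "\<And>x. (\<lambda>y. b x y) summable_on UNIV"
    using assms(2) by (auto simp: graph_def)
  have d: "\<And>x y. 0 \<le> d x y" "\<And>x y. d x y = d y x"
    using assms(3) by (auto simp: intrinsic_metric_def pseudo_metric_def)
  interpret edge_weight b m
    using assms(4) m b by unfold_locales (simp_all add: weighted_degree_def)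
  have "\<exists>\<rho>. edge_lengths b \<rho> m d"
    using assms(5)
  proof
    assume "\<forall>x y. b x y > 0 \<longrightarrow> d x y \<ge> 1"
    then have "edge_lengths b d m d"
      using assms(3) b d m by unfold_locales (simp_all add: intrinsic_metric_def)
    then show ?thesis
      by blast
  next
    assume "\<forall>x y. b x y > 0 \<longrightarrow> d x y \<le> 1"
    then have "edge_lengths b (\<lambda>_ _. 1) m d"
      using assms(4) b d m by unfold_locales (simp_all add: weighted_degree_def)
    then show ?thesis
      by blast
  qed
  then obtain \<rho> where "edge_lengths b \<rho> m d"
    by blast
  then show ?thesis
    by (intro spectral_bottom_ge edge_lengths.Cheeger_inequality)
qed

end
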